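(* Let $f:\mathbb{R}^n\to\mathbb{R}$ be convex with a minimizer $x^*$, let $x^0\in\mathbb{R}^n$, $R_0\ge\|x^0-x^*\|_2$, $R_0>0$, and $Q=B_{3R_0}(x^* )=\{x\in\mathbb{R}^n: \|x-x^*\|_2\le 3R_0\}$. Assume that the stochastic gradient satisfies the oracle condition (unbiasedness and variance at most $\sigma^2$) on $Q$ with $\sigma>0$, and that $f$ satisfies the smoothness conditions with exponent $\nu\in[0,1]$ and constant $M_\nu>0$ on $Q$ (oracle condition and smoothness conditions are spelled out in the context). Let $\varepsilon>0$ and $\beta\in(0,1)$. Then there exists a choice of the parameters of clipped-SSTM (number of iterations $N$, batch sizes $m_k$, stepsize parameter $\alpha$, clipping parameter $B$) such that clipped-SSTM started at $x^0$ achieves $f(y^N)-f(x^* )\le\varepsilon$ with probability at least $1-\beta$ after $$\mathcal{O}\left(D\ln^{\frac{2(1+\nu)}{1+3\nu}}\frac{D}{\beta}\right)\ \text{iterations},\qquad D=\frac{M_\nu^{\frac{2}{1+3\nu}}R_0^{\frac{2(1+\nu)}{1+3\nu}}}{\varepsilon^{\frac{2}{1+3\nu}}},$$ and requires $$\mathcal{O}\left(\max\left\{D\ln^{\frac{2(1+\nu)}{1+3\nu}}\frac{D}{\beta},\ \frac{\sigma^2R_0^2}{\varepsilon^2}\ln\frac{D}{\beta}\right\}\right)\ \text{oracle calls}.$$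
   Context: Problem: minimize $f(x)=\mathbb{E}_\xi[f(x,\xi)]$ over $\mathbb{R}^n$; $x^*$ is a solution. Oracle condition on $Q$: at each $x\in\mathbb{R}^n$ one can sample a stochastic gradient $\nabla f(x,\xi)$ with $\mathbb{E}_\xi\|\nabla f(x,\xi)-\nabla f(x)\|_2^2<\infty$, and for $x\in Q$: $\mathbb{E}_\xi[\nabla f(x,\xi)]=\nabla f(x)$ and $\mathbb{E}_\xi\|\nabla f(x,\xi)-\nabla f(x)\|_2^2\le\sigma^2$. No other tail assumption is made. Smoothness conditions on $Q$ with $(\nu,M_\nu)$: (i) $\|\nabla f(x)-\nabla f(y)\|_2\le M_\nu\|x-y\|_2^\nu$ for all $x,y\in Q$; (ii) $\|\nabla f(x)\|_2\le\left(\frac{1+\nu}{\nu}\right)^{\frac{\nu}{1+\nu}}M_\nu^{\frac{1}{1+\nu}}(f(x)-f(x^* ))^{\frac{\nu}{1+\nu}}$ for all $x\in Q$ (for $\nu=0$ the factor $(\frac{1+\nu}{\nu})^{\frac{\nu}{1+\nu}}$ is its limit $1$, so the bound reads $\|\nabla f(x)\|_2\le M_0$); (iii) $\|\nabla f(x)\|_2^2\le 2(1/\delta)^{\frac{1-\nu}{1+\nu}}M_\nu^{\frac{2}{1+\nu}}(f(x)-f(x^* ))+\delta^{\frac{2\nu}{1+\nu}}M_\nu^{\frac{2}{1+\nu}}$ for all $x\in Q$, $\delta>0$. For $\nu=0$, $f$ need not be differentiable and $\nabla f(x)$ denotes a subgradient (with $\nabla f(x^* )=0$). Clipping: $\mathrm{clip}(g,\lambda)=\min\{1,\lambda/\|g\|_2\}\,g$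 (and $\mathrm{clip}(0,\lambda)=0$). Algorithm clipped-SSTM with starting point $x^0$, number of iterations $N$, batch sizes $m_0,\dots,m_{N-1}\in\mathbb{Z}_{\ge1}$, stepsize parameter $\alpha>0$, clipping parameter $B>0$: set $A_0=\alpha_0=0$, $y^0=z^0=x^0$. For $k=0,\dots,N-1$: $\alpha_{k+1}=\alpha(k+1)^{\frac{2\nu}{1+\nu}}$, $A_{k+1}=A_k+\alpha_{k+1}$, $\lambda_{k+1}=B/\alpha_{k+1}$; $x^{k+1}=(A_ky^k+\alpha_{k+1}z^k)/A_{k+1}$; draw fresh i.i.d. samples $\xi_1^k,\dots,\xi_{m_k}^k$, let $\nabla f(x^{k+1},\boldsymbol\xi^k)=\frac1{m_k}\sum_{i=1}^{m_k}\nabla f(x^{k+1},\xi_i^k)$ and $\widetilde\nabla f(x^{k+1},\boldsymbol\xi^k)=\mathrm{clip}(\nabla f(x^{k+1},\boldsymbol\xi^k),\lambda_{k+1})$; $z^{k+1}=z^k-\alpha_{k+1}\widetilde\nabla f(x^{k+1},\boldsymbol\xi^k)$; $y^{k+1}=(A_ky^k+\alpha_{k+1}z^{k+1})/A_{k+1}$. Output: $y^N$. The number of oracle calls is the total number of computed stochastic gradients $\nabla f(x,\xi)$, i.e. $\sum_{k=0}^{N-1}m_k$. The parameters may depend on $\nu,M_\nu,R_0,\sigma,\varepsilon,\beta$. $\mathcal{O}(\cdot)$ hides numerical constant factors (for fixed $\nu$), independent of $f,n,M_\nu,R_0,\sigma,\varepsilon,\beta$.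
   Formalization: In both complexity bounds ln(D/β) is read as max{1, ln(D/β)}, since the literal bound is undefined or negative for D<β and fails for ν=0 when D and β approach 1. *)

theory Defs
  imports "HOL-Probability.Probability"
begin

text \<open>
  The dimension is quantified inside the statement (the hidden constant and the parameters of the
  method must not depend on it), so \<open>\<real>\<^sup>n\<close> is the carrier of the library's \<^const>\<open>Euclidean_space\<close>: real
  sequences vanishing from index \<open>n\<close> on. The library's metric on \<open>nat \<Rightarrow> real\<close> is not the Euclidean
  one and is not used; the topology is the product topology, so \<^const>\<open>borel\<close> on \<open>nat \<Rightarrow> real\<close> is
  generated by the coordinates.
\<close>

type_synonym vec = "nat \<Rightarrow> real"

abbreviation Rn :: "nat \<Rightarrow> vec set" where
  "Rn n \<equiv> topspace (Euclidean_space n)"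

abbreviation borel_Rn :: "nat \<Rightarrow> vec measure" where
  "borel_Rn n \<equiv> restrict_space borel (Rn n)"

definition inner_Rn :: "nat \<Rightarrow> vec \<Rightarrow> vec \<Rightarrow> real" where
  "inner_Rn n x y = (\<Sum>i<n. x i * y i)"

definition norm_Rn :: "nat \<Rightarrow> vec \<Rightarrow> real" where
  "norm_Rn n x = L2_set x {..<n}"

definition dist_Rn :: "nat \<Rightarrow> vec \<Rightarrow> vec \<Rightarrow> real" where
  "dist_Rn n x y = norm_Rn n (\<lambda>i. x i - y i)"

definition cball_Rn :: "nat \<Rightarrow> vec \<Rightarrow> real \<Rightarrow> vec set" where
  "cball_Rn n c r = {x \<in> Rn n. dist_Rn n x c \<le> r}"

definition convex_Rn :: "nat \<Rightarrow> (vec \<Rightarrow> real) \<Rightarrow> bool" where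
  "convex_Rn n f \<longleftrightarrow>
    (\<forall>x\<in>Rn n. \<forall>y\<in>Rn n. \<forall>t\<in>{0..1}.
      f (\<lambda>i. (1 - t) * x i + t * y i) \<le> (1 - t) * f x + t * f y)"

definition is_minimizer :: "nat \<Rightarrow> (vec \<Rightarrow> real) \<Rightarrow> vec \<Rightarrow> bool" where
  "is_minimizer n f xs \<longleftrightarrow> xs \<in> Rn n \<and> (\<forall>x\<in>Rn n. f xs \<le> f x)"

definition is_subgradient :: "nat \<Rightarrow> (vec \<Rightarrow> real) \<Rightarrow> vec \<Rightarrow> vec \<Rightarrow> bool" where
  "is_subgradient n f x v \<longleftrightarrow> v \<in> Rn n \<and>
    (\<forall>y\<in>Rn n. f x + inner_Rn n v (\<lambda>i. y i - x i) \<le> f y)"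

definition is_gradient :: "nat \<Rightarrow> (vec \<Rightarrow> real) \<Rightarrow> vec \<Rightarrow> vec \<Rightarrow> bool" where
  "is_gradient n f x v \<longleftrightarrow> v \<in> Rn n \<and>
    (\<forall>e>0. \<exists>d>0. \<forall>y\<in>Rn n. dist_Rn n y x < d \<longrightarrow>
      \<bar>f y - f x - inner_Rn n v (\<lambda>i. y i - x i)\<bar> \<le> e * dist_Rn n y x)"

text \<open>
  \<open>gradient_field n \<nu> f xs Q df\<close>: the map \<open>df\<close> is what is written \<open>\<nabla>f\<close>. For \<open>\<nu> > 0\<close> it is the
  gradient on \<open>Q\<close>. Off \<open>Q\<close> only a subgradient is required, which for convex \<open>f\<close> covers the gradient
  of an everywhere differentiable function. For \<open>\<nu> = 0\<close> it is a selection of subgradients vanishing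
  at the minimizer.
\<close>

definition gradient_field ::
    "nat \<Rightarrow> real \<Rightarrow> (vec \<Rightarrow> real) \<Rightarrow> vec \<Rightarrow> vec set \<Rightarrow> (vec \<Rightarrow> vec) \<Rightarrow> bool" where
  "gradient_field n \<nu> f xs Q df \<longleftrightarrow>
    (\<forall>x\<in>Rn n. is_subgradient n f x (df x)) \<and>
    (if \<nu> = 0 then df xs = (\<lambda>_. 0) else (\<forall>x\<in>Q. is_gradient n f x (df x)))"

text \<open>
  In the second condition the case \<open>\<nu> = 0\<close> is spelled out because the factor
  \<open>((1 + \<nu>) / \<nu>) powr (\<nu> / (1 + \<nu>))\<close> would evaluate to \<open>0\<close> there instead of its limit \<open>1\<close>.
\<close>

definition smoothness_cond ::
    "nat \<Rightarrow> real \<Rightarrow> real \<Rightarrow> (vec \<Rightarrow> real) \<Rightarrow> vec \<Rightarrow> vec set \<Rightarrow> (vec \<Rightarrow> vec) \<Rightarrow> bool" where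
  "smoothness_cond n \<nu> M f xs Q df \<longleftrightarrow>
    (\<forall>x\<in>Q. \<forall>y\<in>Q. dist_Rn n (df x) (df y) \<le> M * dist_Rn n x y powr \<nu>) \<and>
    (\<forall>x\<in>Q. norm_Rn n (df x) \<le>
      (if \<nu> = 0 then M
       else ((1 + \<nu>) / \<nu>) powr (\<nu> / (1 + \<nu>)) * M powr (1 / (1 + \<nu>))
              * (f x - f xs) powr (\<nu> / (1 + \<nu>)))) \<and>
    (\<forall>x\<in>Q. \<forall>\<delta>>0. (norm_Rn n (df x))\<^sup>2 \<le>
      2 * (1 / \<delta>) powr ((1 - \<nu>) / (1 + \<nu>)) * M powr (2 / (1 + \<nu>)) * (f x - f xs)
        + \<delta> powr (2 * \<nu> / (1 + \<nu>)) * M powr (2 / (1 + \<nu>)))"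

text \<open>
  \<open>g x \<xi>\<close> is the stochastic gradient \<open>\<nabla>f(x, \<xi>)\<close> and \<open>P\<close> the distribution of \<open>\<xi>\<close>. Joint measurability
  makes the iterates of the method random variables; it includes \<open>g x \<xi> \<in> \<real>\<^sup>n\<close>.
\<close>

definition oracle_cond ::
    "nat \<Rightarrow> real \<Rightarrow> vec set \<Rightarrow> (vec \<Rightarrow> vec) \<Rightarrow> 'xi measure \<Rightarrow> (vec \<Rightarrow> 'xi \<Rightarrow> vec) \<Rightarrow> bool" where
  "oracle_cond n \<sigma> Q df P g \<longleftrightarrow>
    prob_space P \<and>
    (\<lambda>(x, \<xi>). g x \<xi>) \<in> borel_Rn n \<Otimes>\<^sub>M P \<rightarrow>\<^sub>M borel_Rn n \<and>
    (\<forall>x\<in>Rn n. integrable P (\<lambda>\<xi>. (dist_Rn n (g x \<xi>) (df x))\<^sup>2)) \<and>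
    (\<forall>x\<in>Q. (\<forall>i<n. integrable P (\<lambda>\<xi>. g x \<xi> i) \<and> (\<integral>\<xi>. g x \<xi> i \<partial>P) = df x i) \<and>
           (\<integral>\<xi>. (dist_Rn n (g x \<xi>) (df x))\<^sup>2 \<partial>P) \<le> \<sigma>\<^sup>2)"

definition clip :: "nat \<Rightarrow> real \<Rightarrow> vec \<Rightarrow> vec" where
  "clip n l v = (if norm_Rn n v = 0 then (\<lambda>_. 0) else (\<lambda>i. min 1 (l / norm_Rn n v) * v i))"

definition sstm_alpha :: "real \<Rightarrow> real \<Rightarrow> nat \<Rightarrow> real" where
  "sstm_alpha \<nu> \<alpha> k = (if k = 0 then 0 else \<alpha> * real k powr (2 * \<nu> / (1 + \<nu>)))"

definition sstm_A :: "real \<Rightarrow> real \<Rightarrow> nat \<Rightarrow> real" where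
  "sstm_A \<nu> \<alpha> k = (\<Sum>j\<le>k. sstm_alpha \<nu> \<alpha> j)"

text \<open>A realization \<open>\<omega>\<close> of the samples has \<open>\<omega> (k, j)\<close> as the \<open>j\<close>-th sample of iteration \<open>k\<close>.\<close>

definition batch_grad ::
    "(vec \<Rightarrow> 'xi \<Rightarrow> vec) \<Rightarrow> (nat \<Rightarrow> nat) \<Rightarrow> (nat \<times> nat \<Rightarrow> 'xi) \<Rightarrow> nat \<Rightarrow> vec \<Rightarrow> vec" where
  "batch_grad g m \<omega> k x = (\<lambda>i. (1 / real (m k)) * (\<Sum>j<m k. g x (\<omega> (k, j)) i))"

text \<open>The pair \<open>(y\<^sup>k, z\<^sup>k)\<close> of clipped-SSTM after \<open>k\<close> iterations.\<close>

primrec sstm_yz ::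
    "nat \<Rightarrow> real \<Rightarrow> (nat \<Rightarrow> nat) \<Rightarrow> real \<Rightarrow> real \<Rightarrow> (vec \<Rightarrow> 'xi \<Rightarrow> vec) \<Rightarrow> vec \<Rightarrow> (nat \<times> nat \<Rightarrow> 'xi)
      \<Rightarrow> nat \<Rightarrow> vec \<times> vec" where
  "sstm_yz n \<nu> m \<alpha> B g x0 \<omega> 0 = (x0, x0)"
| "sstm_yz n \<nu> m \<alpha> B g x0 \<omega> (Suc k) =
    (let (y, z) = sstm_yz n \<nu> m \<alpha> B g x0 \<omega> k;
         a = sstm_alpha \<nu> \<alpha> (Suc k);
         A = sstm_A \<nu> \<alpha> k;
         A' = sstm_A \<nu> \<alpha> (Suc k);
         x = (\<lambda>i. (A * y i + a * z i) / A');
         G = clip n (B / a) (batch_grad g m \<omega> k x);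
         z' = (\<lambda>i. z i - a * G i);
         y' = (\<lambda>i. (A * y i + a * z' i) / A')
     in (y', z'))"

definition sstm_output ::
    "nat \<Rightarrow> real \<Rightarrow> nat \<Rightarrow> (nat \<Rightarrow> nat) \<Rightarrow> real \<Rightarrow> real \<Rightarrow> (vec \<Rightarrow> 'xi \<Rightarrow> vec) \<Rightarrow> vec
      \<Rightarrow> (nat \<times> nat \<Rightarrow> 'xi) \<Rightarrow> vec" where
  "sstm_output n \<nu> N m \<alpha> B g x0 \<omega> = fst (sstm_yz n \<nu> m \<alpha> B g x0 \<omega> N)"

text \<open>Independent samples of distribution \<open>P\<close>, one for each oracle call of the run.\<close>

definition sample_space ::
    "nat \<Rightarrow> (nat \<Rightarrow> nat) \<Rightarrow> 'xi measure \<Rightarrow> (nat \<times> nat \<Rightarrow> 'xi) measure" where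
  "sample_space N m P = Pi\<^sub>M (SIGMA k:{..<N}. {..<m k}) (\<lambda>_. P)"

definition oracle_calls :: "nat \<Rightarrow> (nat \<Rightarrow> nat) \<Rightarrow> nat" where
  "oracle_calls N m = (\<Sum>k<N. m k)"

definition rate_D :: "real \<Rightarrow> real \<Rightarrow> real \<Rightarrow> real \<Rightarrow> real" where
  "rate_D \<nu> M R0 \<epsilon> =
    M powr (2 / (1 + 3 * \<nu>)) * R0 powr (2 * (1 + \<nu>) / (1 + 3 * \<nu>)) / \<epsilon> powr (2 / (1 + 3 * \<nu>))"

text \<open>
  The logarithm \<open>ln (D / \<beta>)\<close> inside the order bounds. Below \<open>1\<close> it is replaced by \<open>1\<close>: it can be
  negative, and without this a bound by a constant multiple fails for \<open>\<nu> = 0\<close> when \<open>D\<close> and \<open>\<beta>\<close>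
  approach \<open>1\<close>, since it would then force \<open>N = 0\<close>.
\<close>

definition log_factor :: "real \<Rightarrow> real \<Rightarrow> real" where
  "log_factor D \<beta> = max 1 (ln (D / \<beta>))"

definition iteration_bound :: "real \<Rightarrow> real \<Rightarrow> real \<Rightarrow> real" where
  "iteration_bound \<nu> D \<beta> = D * log_factor D \<beta> powr (2 * (1 + \<nu>) / (1 + 3 * \<nu>))"

end

theory Submission
  imports Defs
begin

text \<open>
Write \<open>a\<^sub>k\<close>, \<open>A\<^sub>k\<close> for the weights of clipped-SSTM, \<open>x\<close> for the point queried in the current iteration,
\<open>G\<close> for the clipped mini-batch gradient there, and \<open>\<theta> = G - \<nabla>f(x)\<close> for its error. The proof follows
the energy \<open>E\<^sub>k = A\<^sub>k (f(y\<^sup>k) - f(x\<^sup>*)) + \<parallel>z\<^sup>k - x\<^sup>*\<parallel>\<^sup>2 / 2\<close> and shows that with probability at least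
\<open>1 - \<beta>\<close> it never exceeds \<open>2 R\<^sub>0\<^sup>2\<close>. On that event \<open>f(y\<^sup>N) - f(x\<^sup>*) \<le> 2 R\<^sub>0\<^sup>2 / A\<^sub>N \<le> \<epsilon>\<close>.

Deterministic part (\<open>sstm_step\<close>). As long as the iterates stay in the ball \<open>Q\<close>, one iteration
increases the energy by at most \<open>e + W\<close>, where
\<open>W = a\<^sup>2 \<parallel>\<theta>\<parallel>\<^sup>2 - a \<langle>\<theta>, z - x\<^sup>*\<rangle>\<close> is noise and \<open>e\<close> is the price for Hoelder instead of Lipschitz
gradients. The descent inequality starts from the subgradient at the new point,
\<open>f(y') - f(x) \<le> \<langle>\<nabla>f(y'), y' - x\<rangle>\<close>, and compares \<open>\<nabla>f(y')\<close> with \<open>\<nabla>f(x)\<close>. The step size is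
chosen so that all \<open>e\<close> together cost at most \<open>R\<^sub>0\<^sup>2 / 2\<close> (\<open>sum_err\<close>).

Noise (\<open>exp_clipped_noise_le\<close>). While the energy is at most \<open>2 R\<^sub>0\<^sup>2\<close>, the true gradient at \<open>x\<close>
is at most half the clipping level (\<open>gradient_unclipped\<close>). Then clipping moves no point away from
\<open>\<nabla>f(x)\<close>, and it changes a vector \<open>v\<close> by at most \<open>\<parallel>v - \<nabla>f(x)\<parallel>\<^sup>2\<close> over twice the clipping level.
Hence \<open>exp (W / (6 B R\<^sub>0))\<close> lies, pointwise, below one plus a linear plus a quadratic function of
the unclipped error. The linear term has mean zero and the quadratic one is controlled by the
variance of the mini-batch, so that the batch sizes make the conditional expectation at most
\<open>exp (L / N)\<close>, with \<open>L\<close> the logarithmic factor.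

Probability (\<open>killed_supermartingale\<close>). Thus \<open>exp ((E\<^sub>k - 2 R\<^sub>0\<^sup>2) / (6 B R\<^sub>0))\<close>, corrected by the
errors still to come and replaced by 1 from the first time that the energy exceeds \<open>2 R\<^sub>0\<^sup>2\<close>, is a
supermartingale. Its initial value \<open>exp (- L) \<le> \<beta>\<close> bounds the probability of ever leaving the
controlled regime. Freezing the process at the first violation controls all iterations by a
single exponential bound, and it lets every estimate above be used under the assumption that
the energy has been small so far.

Rate. With \<open>X = M\<^sub>\<nu> R\<^sub>0\<^sup>1\<^sup>+\<^sup>\<nu> / \<epsilon>\<close> the requirements on \<open>N\<close> are \<open>N \<ge> c L X\<^bsup>1/(1+\<nu>)\<^esup>\<close> (gradients stay below
the clipping level) and \<open>N \<ge> c X\<^bsup>2/(1+3\<nu>)\<^esup> = c D\<close> (accelerated rate). Both follow from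
\<open>N \<ge> c D L\<^bsup>2(1+\<nu>)/(1+3\<nu>)\<^esup>\<close> when \<open>D > 1\<close>. When \<open>D \<le> 1\<close> the starting point is already
\<open>\<epsilon>\<close>-accurate and no iteration is made.
\<close>


section \<open>Euclidean geometry of \<open>\<real>\<^sup>n\<close> and clipping\<close>

lemma norm_Rn_nonneg [simp]: "0 \<le> norm_Rn n x"
  by (simp add: norm_Rn_def)

lemma norm_Rn_sq: "(norm_Rn n x)\<^sup>2 = inner_Rn n x x"
  by (simp add: norm_Rn_def inner_Rn_def L2_set_def sum_nonneg power2_eq_square)

lemma abs_inner_Rn_le: "\<bar>inner_Rn n x y\<bar> \<le> norm_Rn n x * norm_Rn n y"
proof -
  have "\<bar>inner_Rn n x y\<bar> \<le> (\<Sum>i<n. \<bar>x i\<bar> * \<bar>y i\<bar>)"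
    unfolding inner_Rn_def by (rule order_trans[OF sum_abs]) (simp add: abs_mult)
  also have "\<dots> \<le> norm_Rn n x * norm_Rn n y"
    unfolding norm_Rn_def by (rule L2_set_mult_ineq)
  finally show ?thesis .
qed

lemma inner_Rn_le: "inner_Rn n x y \<le> norm_Rn n x * norm_Rn n y"
  using abs_inner_Rn_le[of n x y] by linarith

lemma norm_Rn_add: "norm_Rn n (\<lambda>i. x i + y i) \<le> norm_Rn n x + norm_Rn n y"
  unfolding norm_Rn_def by (rule L2_set_triangle_ineq)

lemma norm_Rn_scale: "norm_Rn n (\<lambda>i. c * x i) = \<bar>c\<bar> * norm_Rn n x"
proof -
  have "norm_Rn n (\<lambda>i. c * x i) = sqrt (c\<^sup>2 * (\<Sum>i<n. (x i)\<^sup>2))"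
    unfolding norm_Rn_def L2_set_def by (simp add: power_mult_distrib sum_distrib_left)
  also have "\<dots> = \<bar>c\<bar> * norm_Rn n x"
    unfolding norm_Rn_def L2_set_def by (simp add: real_sqrt_mult)
  finally show ?thesis .
qed

lemma norm_Rn_minus_commute: "norm_Rn n (\<lambda>i. x i - y i) = norm_Rn n (\<lambda>i. y i - x i)"
  using norm_Rn_scale[of n "-1" "\<lambda>i. y i - x i"] by simp

lemma dist_Rn_commute: "dist_Rn n x y = dist_Rn n y x"
  unfolding dist_Rn_def by (rule norm_Rn_minus_commute)

lemma dist_Rn_nonneg [simp]: "0 \<le> dist_Rn n x y"
  by (simp add: dist_Rn_def)

lemma dist_Rn_triangle: "dist_Rn n x z \<le> dist_Rn n x y + dist_Rn n y z"
  unfolding dist_Rn_def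
  using norm_Rn_add[of n "\<lambda>i. x i - y i" "\<lambda>i. y i - z i"] by simp

lemma norm_Rn_le_dist: "norm_Rn n x \<le> dist_Rn n x y + norm_Rn n y"
  unfolding dist_Rn_def
  using norm_Rn_add[of n "\<lambda>i. x i - y i" y] by simp

lemma dist_Rn_self [simp]: "dist_Rn n x x = 0"
  by (simp add: dist_Rn_def norm_Rn_def L2_set_def)

lemma norm_Rn_cong: "(\<And>i. i < n \<Longrightarrow> x i = y i) \<Longrightarrow> norm_Rn n x = norm_Rn n y"
  unfolding norm_Rn_def by (rule L2_set_cong) auto

lemma dist_Rn_combination:
  assumes "0 \<le> A" "0 \<le> a" "0 < A + a" "dist_Rn n y c \<le> r" "dist_Rn n z c \<le> r"
  shows "dist_Rn n (\<lambda>i. (A * y i + a * z i) / (A + a)) c \<le> r"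
proof -
  have "dist_Rn n (\<lambda>i. (A * y i + a * z i) / (A + a)) c
      = norm_Rn n (\<lambda>i. A / (A + a) * (y i - c i) + a / (A + a) * (z i - c i))"
    unfolding dist_Rn_def
  proof (rule norm_Rn_cong)
    fix i
    have "A * c i + a * c i = (A + a) * c i" by (simp add: algebra_simps)
    then have "c i = (A * c i + a * c i) / (A + a)" using assms(3) by simp
    then have "(A * y i + a * z i) / (A + a) - c i
        = (A * y i + a * z i) / (A + a) - (A * c i + a * c i) / (A + a)" by simp
    also have "\<dots> = (A * (y i - c i) + a * (z i - c i)) / (A + a)"
      by (simp add: diff_divide_distrib[symmetric] algebra_simps)
    finally show "(A * y i + a * z i) / (A + a) - c i
        = A / (A + a) * (y i - c i) + a / (A + a) * (z i - c i)"
      by (simp add: add_divide_distrib)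
  qed
  also have "\<dots> \<le> A / (A + a) * dist_Rn n y c + a / (A + a) * dist_Rn n z c"
    using assms norm_Rn_add[of n "\<lambda>i. A / (A + a) * (y i - c i)" "\<lambda>i. a / (A + a) * (z i - c i)"]
    by (simp only: norm_Rn_scale dist_Rn_def) simp
  also have "\<dots> \<le> A / (A + a) * r + a / (A + a) * r"
    by (intro add_mono mult_left_mono) (use assms in auto)
  also have "\<dots> = r"
    using assms(3) by (simp add: distrib_right[symmetric] add_divide_distrib[symmetric])
  finally show ?thesis .
qed

lemma Rn_iff: "x \<in> Rn n \<longleftrightarrow> (\<forall>i\<ge>n. x i = 0)"
  by (simp add: topspace_Euclidean_space)

lemma norm_Rn_eq_0_iff: "norm_Rn n x = 0 \<longleftrightarrow> (\<forall>i<n. x i = 0)"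
  by (auto simp: norm_Rn_def L2_set_eq_0_iff)

lemma norm_Rn_scale_diff_sq:
  "(norm_Rn n (\<lambda>i. c * v i - w i))\<^sup>2
    = c\<^sup>2 * (norm_Rn n v)\<^sup>2 - 2 * c * inner_Rn n v w + (norm_Rn n w)\<^sup>2"
  unfolding norm_Rn_sq inner_Rn_def sum_distrib_left sum.distrib[symmetric] sum_subtractf[symmetric]
  by (rule sum.cong) (auto simp: power2_eq_square algebra_simps)

lemma clip_inside:
  assumes "norm_Rn n v \<le> l" "i < n"
  shows "clip n l v i = v i"
proof (cases "norm_Rn n v = 0")
  case True
  then show ?thesis using assms(2) by (simp add: clip_def norm_Rn_eq_0_iff)
next
  case False
  then have "1 \<le> l / norm_Rn n v"
    using assms(1) norm_Rn_nonneg[of n v] by (auto simp: le_divide_eq_1 less_le)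
  then show ?thesis using False by (simp add: clip_def)
qed

lemma clip_outside:
  assumes "0 < l" "l < norm_Rn n v"
  shows "clip n l v = (\<lambda>i. l / norm_Rn n v * v i)"
  using assms by (auto simp: clip_def min_def field_simps)

lemma norm_clip_le:
  assumes "0 < l"
  shows "norm_Rn n (clip n l v) \<le> l"
proof (cases "norm_Rn n v \<le> l")
  case True
  then have "norm_Rn n (clip n l v) = norm_Rn n v"
    by (intro norm_Rn_cong clip_inside)
  then show ?thesis using True by simp
next
  case False
  then have "norm_Rn n (clip n l v) = \<bar>l / norm_Rn n v\<bar> * norm_Rn n v"
    using assms norm_Rn_scale[of n "l / norm_Rn n v" v] by (simp add: clip_outside)
  then show ?thesis using False assms by simp
qed

text \<open>
Clipping at level \<open>l\<close> is the metric projection onto the ball of radius \<open>l\<close>. Only points \<open>w\<close> of the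
ball are compared with, and then stretching \<open>clip v\<close> back to \<open>v\<close> moves away from \<open>w\<close>.
\<close>
lemma clip_nonexpansive:
  assumes "0 < l" "norm_Rn n w \<le> l"
  shows "norm_Rn n (\<lambda>i. clip n l v i - w i) \<le> norm_Rn n (\<lambda>i. v i - w i)"
proof (cases "norm_Rn n v \<le> l")
  case True
  then have "norm_Rn n (\<lambda>i. clip n l v i - w i) = norm_Rn n (\<lambda>i. v i - w i)"
    by (intro norm_Rn_cong) (simp add: clip_inside)
  then show ?thesis by simp
next
  case False
  define V where "V = norm_Rn n v"
  define I where "I = inner_Rn n v w"
  have V: "l < V" "0 < V" using False assms by (auto simp: V_def)
  have I: "I \<le> V * l"
    using inner_Rn_le[of n v w] mult_left_mono[OF assms(2), of V] V
    unfolding I_def V_def by linarith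
  have "(norm_Rn n (\<lambda>i. clip n l v i - w i))\<^sup>2 = l\<^sup>2 - 2 * (l / V) * I + (norm_Rn n w)\<^sup>2"
    using V assms norm_Rn_scale_diff_sq[of n "l / V" v w]
    by (simp add: clip_outside flip: V_def I_def) (simp add: power_divide)
  also have "\<dots> \<le> V\<^sup>2 - 2 * I + (norm_Rn n w)\<^sup>2"
  proof -
    have "2 * I * (1 - l / V) \<le> 2 * (V * l) * (1 - l / V)"
      using I V by (intro mult_right_mono) auto
    also have "\<dots> = 2 * V * l - 2 * l\<^sup>2"
      using V by (simp add: field_simps power2_eq_square)
    also have "\<dots> \<le> V\<^sup>2 - l\<^sup>2"
      using zero_le_power2[of "V - l"] by (simp add: power2_diff)
    finally show ?thesis by (simp add: algebra_simps)
  qed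
  also have "\<dots> = (norm_Rn n (\<lambda>i. v i - w i))\<^sup>2"
    using norm_Rn_scale_diff_sq[of n 1 v w] by (simp add: V_def I_def)
  finally show ?thesis by (rule power2_le_imp_le) simp
qed

text \<open>
This is the source of the small bias of clipped gradients: if \<open>v\<close> is clipped at all, it is at least
\<open>l / 2\<close> away from \<open>w\<close>, so that the truncated length \<open>\<parallel>v\<parallel> - l \<le> d - l / 2\<close>, where \<open>d = \<parallel>v - w\<parallel>\<close>,
is dominated by \<open>d\<^sup>2 / (2 l)\<close>.
\<close>
lemma clip_error_le:
  assumes "0 < l" "norm_Rn n w \<le> l / 2"
  shows "norm_Rn n (\<lambda>i. clip n l v i - v i) \<le> (norm_Rn n (\<lambda>i. v i - w i))\<^sup>2 / (2 * l)"
proof (cases "norm_Rn n v \<le> l")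
  case True
  then have "norm_Rn n (\<lambda>i. clip n l v i - v i) = 0"
    by (auto simp: norm_Rn_eq_0_iff clip_inside)
  then show ?thesis using assms by simp
next
  case False
  define V where "V = norm_Rn n v"
  define d where "d = norm_Rn n (\<lambda>i. v i - w i)"
  have V: "l < V" "0 < V" using False assms by (auto simp: V_def)
  have "(\<lambda>i. clip n l v i - v i) = (\<lambda>i. (l / V - 1) * v i)"
    using V assms by (simp add: clip_outside algebra_simps flip: V_def)
  then have "norm_Rn n (\<lambda>i. clip n l v i - v i) = \<bar>l / V - 1\<bar> * V"
    by (simp add: norm_Rn_scale V_def)
  also have "\<dots> = V - l" using V by (simp add: field_simps)
  also have "\<dots> \<le> d - l / 2"
    using norm_Rn_le_dist[of n v w] assms by (simp add: V_def d_def dist_Rn_def)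
  also have "\<dots> \<le> d\<^sup>2 / (2 * l)"
    using zero_le_power2[of "d - l"] assms(1)
    by (simp add: field_simps power2_eq_square)
  finally show ?thesis by (simp add: d_def)
qed

section \<open>Convex functions with Hoelder continuous subgradients\<close>

lemma inner_Rn_diff_left: "inner_Rn n (\<lambda>i. x i - y i) z = inner_Rn n x z - inner_Rn n y z"
  by (simp add: inner_Rn_def algebra_simps sum_subtractf)

lemma inner_Rn_scale_right: "inner_Rn n x (\<lambda>i. c * y i) = c * inner_Rn n x y"
  by (simp add: inner_Rn_def sum_distrib_left algebra_simps)

lemma Rn_combination:
  "\<lbrakk>y \<in> Rn n; z \<in> Rn n\<rbrakk> \<Longrightarrow> (\<lambda>i. (A * y i + a * z i) / c) \<in> Rn n"
  by (simp add: Rn_iff)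

text \<open>
A Young inequality with explicit threshold \<open>\<tau>\<close>: below \<open>\<tau>\<close> the power is bounded by its value at \<open>\<tau>\<close>,
above \<open>\<tau>\<close> by a quadratic. It covers \<open>\<nu> = 0\<close> and \<open>\<nu> = 1\<close> without limits of exponents.
\<close>
lemma power_holder_split:
  fixes r \<nu> \<tau> :: real
  assumes "0 \<le> \<nu>" "\<nu> \<le> 1" "0 \<le> r" "0 < \<tau>"
  shows "r powr \<nu> * r \<le> r\<^sup>2 * \<tau> powr (\<nu> - 1) + \<tau> powr (1 + \<nu>)"
proof (cases "r \<le> \<tau>")
  case True
  have "r powr \<nu> * r \<le> \<tau> powr \<nu> * \<tau>"
    by (intro mult_mono powr_mono2) (use True assms in auto)
  also have "\<dots> = \<tau> powr (1 + \<nu>)" using assms by (simp add: powr_add)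
  finally show ?thesis by (simp add: add_increasing)
next
  case False
  have "r powr \<nu> * r = r powr (\<nu> - 1) * r\<^sup>2"
    using False assms by (simp add: powr_diff power2_eq_square)
  also have "\<dots> \<le> \<tau> powr (\<nu> - 1) * r\<^sup>2"
    by (intro mult_right_mono powr_mono2') (use False assms in auto)
  finally show ?thesis by (simp add: add_increasing2 mult.commute)
qed

locale holder_problem =
  fixes n :: nat and \<nu> M R0 :: real and f :: "vec \<Rightarrow> real" and df :: "vec \<Rightarrow> vec" and xs :: vec
  assumes \<nu>: "0 \<le> \<nu>" "\<nu> \<le> 1"
    and M: "0 < M"
    and R0: "0 < R0"
    and minimizer: "is_minimizer n f xs"
    and gradient: "gradient_field n \<nu> f xs (cball_Rn n xs (3 * R0)) df"
    and smooth: "smoothness_cond n \<nu> M f xs (cball_Rn n xs (3 * R0)) df"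
begin

abbreviation Q :: "vec set" where "Q \<equiv> cball_Rn n xs (3 * R0)"

lemma xs_Rn: "xs \<in> Rn n" and f_min: "x \<in> Rn n \<Longrightarrow> f xs \<le> f x"
  using minimizer by (auto simp: is_minimizer_def)

lemma subgradient_le:
  "\<lbrakk>x \<in> Rn n; y \<in> Rn n\<rbrakk> \<Longrightarrow> f x + inner_Rn n (df x) (\<lambda>i. y i - x i) \<le> f y"
  using gradient by (auto simp: gradient_field_def is_subgradient_def)

lemma in_QI: "\<lbrakk>x \<in> Rn n; dist_Rn n x xs \<le> 3 * R0\<rbrakk> \<Longrightarrow> x \<in> Q"
  by (simp add: cball_Rn_def)

lemma Q_Rn: "x \<in> Q \<Longrightarrow> x \<in> Rn n"
  by (simp add: cball_Rn_def)

lemma df_holder: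
  "\<lbrakk>x \<in> Q; y \<in> Q\<rbrakk> \<Longrightarrow> dist_Rn n (df x) (df y) \<le> M * dist_Rn n x y powr \<nu>"
  using smooth by (auto simp: smoothness_cond_def)

lemma xs_Q: "xs \<in> Q"
  using xs_Rn R0 by (simp add: cball_Rn_def)

lemma df_xs: "norm_Rn n (df xs) = 0"
proof (cases "\<nu> = 0")
  case True
  then show ?thesis using gradient by (simp add: gradient_field_def norm_Rn_eq_0_iff)
next
  case False
  then have "norm_Rn n (df xs) \<le> 0"
    using smooth xs_Q by (fastforce simp: smoothness_cond_def)
  then show ?thesis using norm_Rn_nonneg[of n "df xs"] by linarith
qed

lemma norm_df_le_dist:
  assumes "x \<in> Q"
  shows "norm_Rn n (df x) \<le> M * dist_Rn n x xs powr \<nu>"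
  using df_holder[OF assms xs_Q] norm_Rn_le_dist[of n "df x" "df xs"] df_xs by simp

text \<open>
The third smoothness condition taken at \<open>\<delta> = H\<close>, where its two summands balance. Unlike the second
condition it has the same form for \<open>\<nu> = 0\<close>.
\<close>
lemma norm_df_le_gap:
  assumes "x \<in> Q" "f x - f xs \<le> H" "0 < H"
  shows "norm_Rn n (df x) \<le> 2 * M powr (1 / (1 + \<nu>)) * H powr (\<nu> / (1 + \<nu>))"
proof -
  let ?m = "M powr (2 / (1 + \<nu>))" and ?h = "H powr (2 * \<nu> / (1 + \<nu>))"
  have e: "1 - (1 - \<nu>) / (1 + \<nu>) = 2 * \<nu> / (1 + \<nu>)"
    using \<nu> by (simp add: field_simps)
  have inv: "(1 / H) powr ((1 - \<nu>) / (1 + \<nu>)) * H = ?h"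
    using assms(3) by (simp add: powr_divide flip: e) (simp add: powr_diff)
  have "(norm_Rn n (df x))\<^sup>2
      \<le> 2 * (1 / H) powr ((1 - \<nu>) / (1 + \<nu>)) * ?m * (f x - f xs) + ?h * ?m"
    using smooth assms by (auto simp: smoothness_cond_def)
  also have "\<dots> \<le> 2 * (1 / H) powr ((1 - \<nu>) / (1 + \<nu>)) * ?m * H + ?h * ?m"
    by (intro add_right_mono mult_left_mono) (use assms in auto)
  also have "\<dots> = 2 * ?m * ((1 / H) powr ((1 - \<nu>) / (1 + \<nu>)) * H) + ?h * ?m"
    by simp
  also have "\<dots> = 3 * (?m * ?h)"
    unfolding inv by simp
  also have "\<dots> \<le> 4 * (?m * ?h)" by simp
  also have "\<dots> = (2 * M powr (1 / (1 + \<nu>)) * H powr (\<nu> / (1 + \<nu>)))\<^sup>2"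
    using M assms(3) by (simp add: power_mult_distrib powr_power)
  finally show ?thesis
    by (rule power2_le_imp_le) simp
qed

lemma gap_le_dist:
  assumes "x \<in> Q"
  shows "f x - f xs \<le> M * dist_Rn n x xs powr \<nu> * dist_Rn n x xs"
proof -
  have "f x + inner_Rn n (df x) (\<lambda>i. xs i - x i) \<le> f xs"
    using subgradient_le[OF Q_Rn[OF assms] xs_Rn] .
  moreover have "\<bar>inner_Rn n (df x) (\<lambda>i. xs i - x i)\<bar> \<le> norm_Rn n (df x) * dist_Rn n x xs"
    using abs_inner_Rn_le[of n "df x" "\<lambda>i. xs i - x i"] norm_Rn_minus_commute[of n xs x]
    by (simp add: dist_Rn_def)
  moreover have "norm_Rn n (df x) * dist_Rn n x xs \<le> M * dist_Rn n x xs powr \<nu> * dist_Rn n x xs"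
    by (intro mult_right_mono norm_df_le_dist assms) simp
  ultimately show ?thesis by linarith
qed

text \<open>
One iteration with an arbitrary direction \<open>G\<close> in place of the gradient. Convexity at \<open>x\<close> towards \<open>y\<close>
and \<open>x\<^sup>*\<close> turns the function values into \<open>a \<langle>\<nabla>f(x), z - x\<^sup>*\<rangle>\<close>, which the expansion of
\<open>\<parallel>z' - x\<^sup>*\<parallel>\<^sup>2\<close> absorbs up to the error \<open>G - \<nabla>f(x)\<close>. What remains is the negative term
\<open>- a\<^sup>2 \<parallel>G\<parallel>\<^sup>2 / 2\<close>: one half of it pays for the quadratic part of the descent inequality at
\<open>y' = x - a\<^sup>2 / (A + a) G\<close>, the other half for the cross term between \<open>G\<close> and its error.
\<close>
lemma sstm_step:
  assumes "0 \<le> A" "0 < a" "y \<in> Rn n" "z \<in> Rn n"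
    and x_eq: "x = (\<lambda>i. (A * y i + a * z i) / (A + a))"
    and z'_eq: "z' = (\<lambda>i. z i - a * G i)"
    and y'_eq: "y' = (\<lambda>i. (A * y i + a * z' i) / (A + a))"
    and "x \<in> Q" "y' \<in> Q" "0 < \<tau>" "M * (a\<^sup>2 / (A + a)) * \<tau> powr (\<nu> - 1) \<le> 1 / 4"
  shows "(A + a) * (f y' - f xs) + (dist_Rn n z' xs)\<^sup>2 / 2
    \<le> A * (f y - f xs) + (dist_Rn n z xs)\<^sup>2 / 2 + (A + a) * M * \<tau> powr (1 + \<nu>)
      + (a\<^sup>2 * (dist_Rn n G (df x))\<^sup>2
          - a * inner_Rn n (\<lambda>i. G i - df x i) (\<lambda>i. z i - xs i))"
proof -
  define w where "w = (\<lambda>i. z i - xs i)"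
  define \<theta> where "\<theta> = (\<lambda>i. G i - df x i)"
  define u where "u = df x"
  define c where "c = a\<^sup>2 / (A + a)"
  define r where "r = c * norm_Rn n G"
  have A': "0 < A + a" using assms by simp
  have c0: "0 \<le> c" using A' by (simp add: c_def)
  have r0: "0 \<le> r" using c0 by (simp add: r_def)
  have xR: "x \<in> Rn n" and yR': "y' \<in> Rn n" using assms by (auto intro: Q_Rn)
  have xA: "(A + a) * x i = A * y i + a * z i" for i
    using A' by (simp add: x_eq)
  \<comment> \<open>the definition of \<open>x\<close> says \<open>A (y - x) + a (z - x) = 0\<close>, so that \<open>z\<close> can replace \<open>y\<close>\<close>
  have "A * inner_Rn n u (\<lambda>i. y i - x i) + a * inner_Rn n u (\<lambda>i. xs i - x i) + a * inner_Rn n u w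
      = (\<Sum>i<n. u i * (A * (y i - x i) + a * (xs i - x i) + a * w i))"
    unfolding inner_Rn_def sum_distrib_left sum.distrib[symmetric]
    by (rule sum.cong) (auto simp: algebra_simps)
  also have "\<dots> = 0"
  proof (rule sum.neutral, rule ballI)
    fix i
    have "A * (y i - x i) + a * (xs i - x i) + a * w i = A * y i + a * z i - (A + a) * x i"
      by (simp add: w_def algebra_simps)
    then show "u i * (A * (y i - x i) + a * (xs i - x i) + a * w i) = 0"
      using xA by simp
  qed
  finally have lin: "A * inner_Rn n u (\<lambda>i. y i - x i) + a * inner_Rn n u (\<lambda>i. xs i - x i)
      = - (a * inner_Rn n u w)" by simp
  have "A * (f x + inner_Rn n u (\<lambda>i. y i - x i)) \<le> A * f y"
    unfolding u_def by (intro mult_left_mono subgradient_le xR assms)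
  moreover have "a * (f x + inner_Rn n u (\<lambda>i. xs i - x i)) \<le> a * f xs"
    unfolding u_def by (intro mult_left_mono subgradient_le xR xs_Rn) (use assms in auto)
  ultimately have conv: "(A + a) * f x \<le> A * f y + a * f xs + a * inner_Rn n u w"
    using lin by (simp add: algebra_simps)
  have y'x: "y' i - x i = (- c) * G i" for i
  proof -
    have "(A + a) * y' i = A * y i + a * (z i - a * G i)"
      using A' by (simp add: y'_eq z'_eq)
    then have "(A + a) * (y' i - x i) = - (a\<^sup>2 * G i)"
      using xA[of i] by (simp add: right_diff_distrib power2_eq_square)
    then show ?thesis using A' by (simp add: c_def field_simps)
  qed
  have dist_y'x: "dist_Rn n y' x = r"
    unfolding dist_Rn_def y'x norm_Rn_scale r_def using c0 by simp
  \<comment> \<open>descent inequality from the subgradient at the new point \<open>y'\<close>\<close>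
  have "f y' + inner_Rn n (df y') (\<lambda>i. x i - y' i) \<le> f x"
    by (intro subgradient_le xR yR')
  moreover have "(\<lambda>i. x i - y' i) = (\<lambda>i. c * G i)"
    using y'x by (auto simp: fun_eq_iff algebra_simps)
  ultimately have "f y' - f x \<le> - (c * inner_Rn n (df y') G)"
    by (simp add: inner_Rn_scale_right)
  also have "inner_Rn n (df y') G = inner_Rn n u G + inner_Rn n (\<lambda>i. df y' i - u i) G"
    by (simp add: inner_Rn_diff_left)
  also have "- (c * (inner_Rn n u G + inner_Rn n (\<lambda>i. df y' i - u i) G))
      \<le> - (c * inner_Rn n u G) + c * (dist_Rn n (df y') (df x) * norm_Rn n G)"
  proof -
    have "- inner_Rn n (\<lambda>i. df y' i - u i) G \<le> dist_Rn n (df y') (df x) * norm_Rn n G"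
      using abs_inner_Rn_le[of n "\<lambda>i. df y' i - u i" G] by (simp add: dist_Rn_def u_def)
    from mult_left_mono[OF this c0] show ?thesis by (simp add: algebra_simps)
  qed
  also have "c * (dist_Rn n (df y') (df x) * norm_Rn n G) \<le> M * (r powr \<nu> * r)"
  proof -
    have "dist_Rn n (df y') (df x) * r \<le> M * r powr \<nu> * r"
      using df_holder[OF assms(9,8)] r0 by (intro mult_right_mono) (simp_all add: dist_y'x)
    then show ?thesis by (simp add: r_def algebra_simps)
  qed
  also have "M * (r powr \<nu> * r) \<le> M * (r\<^sup>2 * \<tau> powr (\<nu> - 1) + \<tau> powr (1 + \<nu>))"
    by (intro mult_left_mono power_holder_split) (use \<nu> r0 assms M in auto)
  finally have "(A + a) * (f y' - f x)
      \<le> (A + a) * (- (c * inner_Rn n u G) + M * (r\<^sup>2 * \<tau> powr (\<nu> - 1) + \<tau> powr (1 + \<nu>)))"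
    using A' by (intro mult_left_mono) auto
  also have "\<dots> = - (a\<^sup>2 * inner_Rn n u G) + (A + a) * M * \<tau> powr (1 + \<nu>)
      + a\<^sup>2 * (norm_Rn n G)\<^sup>2 * (M * c * \<tau> powr (\<nu> - 1))"
  proof -
    have c: "(A + a) * c = a\<^sup>2" using A' by (simp add: c_def)
    have "(A + a) * r\<^sup>2 = (A + a) * c * (c * (norm_Rn n G)\<^sup>2)"
      by (simp add: r_def power2_eq_square)
    then have r: "(A + a) * r\<^sup>2 = a\<^sup>2 * (c * (norm_Rn n G)\<^sup>2)" unfolding c .
    have "(A + a) * (- (c * inner_Rn n u G) + M * (r\<^sup>2 * \<tau> powr (\<nu> - 1) + \<tau> powr (1 + \<nu>)))
        = - ((A + a) * c * inner_Rn n u G) + (A + a) * M * \<tau> powr (1 + \<nu>)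
          + M * \<tau> powr (\<nu> - 1) * ((A + a) * r\<^sup>2)"
      by (simp add: algebra_simps)
    then show ?thesis unfolding c r by (simp add: algebra_simps)
  qed
  also have "a\<^sup>2 * (norm_Rn n G)\<^sup>2 * (M * c * \<tau> powr (\<nu> - 1)) \<le> a\<^sup>2 * (norm_Rn n G)\<^sup>2 * (1 / 4)"
    using assms by (intro mult_left_mono) (auto simp: c_def)
  finally have desc: "(A + a) * (f y' - f x)
      \<le> - (a\<^sup>2 * inner_Rn n u G) + (A + a) * M * \<tau> powr (1 + \<nu>) + a\<^sup>2 * (norm_Rn n G)\<^sup>2 / 4"
    by simp
  have zz: "(dist_Rn n z' xs)\<^sup>2
      = (dist_Rn n z xs)\<^sup>2 - 2 * a * inner_Rn n G w + a\<^sup>2 * (norm_Rn n G)\<^sup>2"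
  proof -
    have "dist_Rn n z' xs = norm_Rn n (\<lambda>i. a * G i - w i)"
      unfolding dist_Rn_def norm_Rn_minus_commute[of n z'] by (simp add: z'_eq w_def algebra_simps)
    moreover have "dist_Rn n z xs = norm_Rn n w" by (simp add: dist_Rn_def w_def)
    ultimately show ?thesis by (simp add: norm_Rn_scale_diff_sq)
  qed
  have G1: "inner_Rn n G w = inner_Rn n u w + inner_Rn n \<theta> w"
    by (simp add: \<theta>_def u_def inner_Rn_diff_left)
  have G2: "(norm_Rn n G)\<^sup>2 = inner_Rn n u G + inner_Rn n \<theta> G"
    by (simp add: \<theta>_def u_def inner_Rn_diff_left norm_Rn_sq)
  \<comment> \<open>a quarter of \<open>a\<^sup>2 \<parallel>G\<parallel>\<^sup>2\<close> is spent here, the other quarter was spent in \<open>desc\<close>\<close>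
  have "inner_Rn n \<theta> G \<le> norm_Rn n \<theta> * norm_Rn n G" by (rule inner_Rn_le)
  also have "\<dots> \<le> (norm_Rn n \<theta>)\<^sup>2 + (norm_Rn n G)\<^sup>2 / 4"
    using zero_le_power2[of "norm_Rn n \<theta> - norm_Rn n G / 2"]
    by (simp add: power2_eq_square algebra_simps)
  finally have "a\<^sup>2 * inner_Rn n \<theta> G \<le> a\<^sup>2 * ((norm_Rn n \<theta>)\<^sup>2 + (norm_Rn n G)\<^sup>2 / 4)"
    by (intro mult_left_mono) auto
  then have G3: "a\<^sup>2 * (norm_Rn n G)\<^sup>2
      \<le> a\<^sup>2 * inner_Rn n u G + a\<^sup>2 * (norm_Rn n \<theta>)\<^sup>2 + a\<^sup>2 * (norm_Rn n G)\<^sup>2 / 4"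
    unfolding G2[symmetric] by (subst (1) G2) (simp add: algebra_simps)
  have "(A + a) * (f y' - f xs) + (dist_Rn n z' xs)\<^sup>2 / 2
      = (A + a) * (f y' - f x) + (A + a) * f x - (A + a) * f xs + (dist_Rn n z' xs)\<^sup>2 / 2"
    by (simp add: algebra_simps)
  then show ?thesis
    using desc conv zz G3 unfolding G1 dist_Rn_def[of n G]
    unfolding \<theta>_def[symmetric] w_def[symmetric] by (simp add: algebra_simps)
qed

end

section \<open>Moments of clipped mini-batches\<close>

lemma exp_le_quadratic:
  fixes x :: real
  assumes "\<bar>x\<bar> \<le> 1"
  shows "exp x \<le> 1 + x + x\<^sup>2"
proof (cases "0 \<le> x")
  case True
  then show ?thesis using assms exp_bound by simp
next
  case False
  define u where "u = - x"
  have u: "0 \<le> u" using False by (simp add: u_def)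
  have "1 \<le> (1 + u) * (1 - u + u\<^sup>2)"
    using u by (simp add: power2_eq_square algebra_simps)
  also have "\<dots> \<le> exp u * (1 - u + u\<^sup>2)"
  proof (rule mult_right_mono)
    show "1 + u \<le> exp u" by (rule exp_ge_add_one_self)
    show "0 \<le> 1 - u + u\<^sup>2"
      using zero_le_power2[of "u - 1 / 2"] by (simp add: power2_eq_square algebra_simps)
  qed
  finally have "exp (- u) \<le> 1 - u + u\<^sup>2"
    by (simp add: exp_minus field_simps)
  then show ?thesis by (simp add: u_def)
qed

text \<open>
The exponential moment bound behind the concentration argument, before taking expectations. Clipping
bounds the noise by \<open>6 B R\<close>, so that the exponential is at most a quadratic polynomial of it.
In the linear term the clipped error is replaced by the unclipped one \<open>v - \<mu>\<close>, whose
expectation vanishes, at the cost of a bias that is quadratic by \<open>clip_error_le\<close>. All quadratic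
contributions together have coefficient \<open>97 / 144 \<le> 1\<close>.
\<close>
lemma exp_clipped_noise_le:
  fixes v :: vec
  assumes "0 < a" "0 < B" "B \<le> R" "norm_Rn n \<mu> \<le> B / a / 2" "norm_Rn n w \<le> 2 * R"
  defines "G \<equiv> clip n (B / a) v"
  shows "exp ((a\<^sup>2 * (dist_Rn n G \<mu>)\<^sup>2 - a * inner_Rn n (\<lambda>i. G i - \<mu> i) w) / (6 * B * R))
    \<le> 1 - a / (6 * B * R) * inner_Rn n (\<lambda>i. v i - \<mu> i) w + a\<^sup>2 / B\<^sup>2 * (dist_Rn n v \<mu>)\<^sup>2"
proof -
  define l where "l = B / a"
  define q where "q = dist_Rn n G \<mu>"
  define d where "d = dist_Rn n v \<mu>"
  define I where "I = inner_Rn n (\<lambda>i. v i - \<mu> i) w"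
  define W where "W = a\<^sup>2 * q\<^sup>2 - a * inner_Rn n (\<lambda>i. G i - \<mu> i) w"
  have l: "0 < l" "a * l = B" "norm_Rn n \<mu> \<le> l / 2" and R: "0 < R"
    using assms by (auto simp: l_def)
  have q0: "0 \<le> q" and d0: "0 \<le> d" by (simp_all add: q_def d_def)
  have qd: "q \<le> d"
    unfolding q_def d_def dist_Rn_def G_def l_def[symmetric]
    using l by (intro clip_nonexpansive) auto
  have "q \<le> norm_Rn n G + norm_Rn n \<mu>"
    using norm_Rn_add[of n G "\<lambda>i. (- 1) * \<mu> i"] unfolding norm_Rn_scale
    by (simp add: q_def dist_Rn_def)
  also have "\<dots> \<le> 3 / 2 * l"
    using norm_clip_le[OF l(1), of n v] l by (simp add: G_def l_def)
  finally have "a * q \<le> a * (3 / 2 * l)" using assms by (intro mult_left_mono) auto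
  then have aq: "a * q \<le> 3 / 2 * B" using l by simp
  have aq0: "0 \<le> a * q" using assms q0 by simp
  have "\<bar>inner_Rn n (\<lambda>i. G i - \<mu> i) w\<bar> \<le> q * (2 * R)"
    using abs_inner_Rn_le[of n "\<lambda>i. G i - \<mu> i" w] mult_left_mono[OF assms(5) q0]
    by (simp add: q_def dist_Rn_def)
  then have "a * \<bar>inner_Rn n (\<lambda>i. G i - \<mu> i) w\<bar> \<le> a * (q * (2 * R))"
    using assms by (intro mult_left_mono) auto
  then have "\<bar>W\<bar> \<le> a\<^sup>2 * q\<^sup>2 + a * q * (2 * R)"
    unfolding W_def using assms by (intro order_trans[OF abs_triangle_ineq4]) (simp add: abs_mult)
  also have "\<dots> = a * q * (a * q + 2 * R)" by (simp add: power2_eq_square algebra_simps)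
  also have "\<dots> \<le> a * q * (7 / 2 * R)"
    using aq assms aq0 by (intro mult_left_mono) auto
  finally have W1: "\<bar>W\<bar> \<le> a * q * (7 / 2 * R)" .
  also have "\<dots> \<le> 3 / 2 * B * (7 / 2 * R)"
    using aq R by (intro mult_right_mono) auto
  also have "\<dots> \<le> 6 * B * R" using R assms by simp
  finally have W2: "\<bar>W / (6 * B * R)\<bar> \<le> 1"
    using R assms by (simp add: abs_mult field_simps)
  have "W\<^sup>2 \<le> (a * q * (7 / 2 * R))\<^sup>2"
    using W1 by (metis power2_abs power_mono abs_ge_zero)
  also have "\<dots> \<le> (a * d * (7 / 2 * R))\<^sup>2"
    using qd assms R q0 by (intro power_mono mult_right_mono mult_left_mono) auto
  finally have W3: "W\<^sup>2 \<le> 49 / 4 * R\<^sup>2 * (a\<^sup>2 * d\<^sup>2)"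
    by (simp add: power_mult_distrib algebra_simps power2_eq_square)
  have W4: "W \<le> a\<^sup>2 * d\<^sup>2 - a * I + a\<^sup>2 * d\<^sup>2 * (R / B)"
  proof -
    have "inner_Rn n (\<lambda>i. G i - \<mu> i) w = I + inner_Rn n (\<lambda>i. G i - v i) w"
      by (simp add: I_def inner_Rn_diff_left)
    moreover have "\<bar>inner_Rn n (\<lambda>i. G i - v i) w\<bar> \<le> d\<^sup>2 / (2 * l) * (2 * R)"
    proof -
      have "norm_Rn n (\<lambda>i. G i - v i) \<le> d\<^sup>2 / (2 * l)"
        unfolding G_def l_def[symmetric] d_def dist_Rn_def using l by (intro clip_error_le) auto
      then have "norm_Rn n (\<lambda>i. G i - v i) * norm_Rn n w \<le> d\<^sup>2 / (2 * l) * (2 * R)"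
        using assms(5) l by (intro mult_mono) auto
      then show ?thesis using abs_inner_Rn_le[of n "\<lambda>i. G i - v i" w] by linarith
    qed
    ultimately have "a * (- inner_Rn n (\<lambda>i. G i - \<mu> i) w) \<le> a * (- I + d\<^sup>2 / (2 * l) * (2 * R))"
      using assms(1) by (intro mult_left_mono) auto
    also have "\<dots> = - a * I + a\<^sup>2 * d\<^sup>2 * (R / B)"
      using assms by (simp add: l_def field_simps power2_eq_square)
    finally show ?thesis
      using power_mono[OF qd q0, of 2] mult_left_mono[of "q\<^sup>2" "d\<^sup>2" "a\<^sup>2"] by (simp add: W_def)
  qed
  have BR: "1 / (6 * B * R) \<le> 1 / (6 * B\<^sup>2)"
    using assms R by (intro divide_left_mono) (auto simp: power2_eq_square)
  have "exp (W / (6 * B * R)) \<le> 1 + W / (6 * B * R) + (W / (6 * B * R))\<^sup>2"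
    using W2 by (rule exp_le_quadratic)
  also have "(W / (6 * B * R))\<^sup>2 \<le> 49 / 4 * R\<^sup>2 * (a\<^sup>2 * d\<^sup>2) / (6 * B * R)\<^sup>2"
    unfolding power_divide using W3 by (intro divide_right_mono) auto
  also have "\<dots> = 49 / 144 * (a\<^sup>2 * d\<^sup>2 / B\<^sup>2)"
    using R assms by (simp add: power_mult_distrib field_simps)
  also have "W / (6 * B * R) \<le> (a\<^sup>2 * d\<^sup>2 - a * I + a\<^sup>2 * d\<^sup>2 * (R / B)) / (6 * B * R)"
    using W4 R assms by (intro divide_right_mono) auto
  also have "\<dots> = - (a / (6 * B * R) * I) + a\<^sup>2 * d\<^sup>2 * (1 / (6 * B * R)) + a\<^sup>2 * d\<^sup>2 * (1 / (6 * B\<^sup>2))"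
    using R assms by (simp add: field_simps power2_eq_square)
  also have "a\<^sup>2 * d\<^sup>2 * (1 / (6 * B * R)) \<le> a\<^sup>2 * d\<^sup>2 * (1 / (6 * B\<^sup>2))"
    using BR by (intro mult_left_mono) auto
  finally have "exp (W / (6 * B * R)) \<le> 1 - a / (6 * B * R) * I + (97 / 144) * (a\<^sup>2 * d\<^sup>2 / B\<^sup>2)"
    by simp
  also have "(97 / 144) * (a\<^sup>2 * d\<^sup>2 / B\<^sup>2) \<le> 1 * (a\<^sup>2 * d\<^sup>2 / B\<^sup>2)"
    by (intro mult_right_mono) auto
  finally show ?thesis by (simp add: W_def q_def d_def I_def)
qed

text \<open>
The cross terms of the square vanish since \<open>Y\<close> is centred. To read off the expectation of
\<open>Y (\<omega> j) * Y (\<omega> l)\<close> from Fubini's theorem, it is written as a product over all of \<open>J\<close> with factors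
1 off \<open>j\<close> and \<open>l\<close>.
\<close>
lemma (in prob_space) PiM_square_sum:
  fixes Y :: "'a \<Rightarrow> real" and J :: "'j set"
  assumes J: "finite J" and Y: "integrable M Y" "integrable M (\<lambda>x. (Y x)\<^sup>2)" "expectation Y = 0"
  shows "integrable (Pi\<^sub>M J (\<lambda>_. M)) (\<lambda>\<omega>. \<Sum>j\<in>J. Y (\<omega> j))"
    and "(\<integral>\<omega>. (\<Sum>j\<in>J. Y (\<omega> j)) \<partial>Pi\<^sub>M J (\<lambda>_. M)) = 0"
    and "integrable (Pi\<^sub>M J (\<lambda>_. M)) (\<lambda>\<omega>. (\<Sum>j\<in>J. Y (\<omega> j))\<^sup>2)"
    and "(\<integral>\<omega>. (\<Sum>j\<in>J. Y (\<omega> j))\<^sup>2 \<partial>Pi\<^sub>M J (\<lambda>_. M)) = real (card J) * expectation (\<lambda>x. (Y x)\<^sup>2)"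
proof -
  interpret prod: product_prob_space "\<lambda>_. M" J
    by unfold_locales
  let ?PM = "Pi\<^sub>M J (\<lambda>_. M)"
  define h where "h = (\<lambda>(j::'j) i x. if i = j then Y x else 1)"
  have h_int: "integrable M (h j i)" and h_int2: "integrable M (\<lambda>x. h j i x * h l i x)" for j l i
    using Y by (cases "i = j"; cases "i = l"; simp add: h_def power2_eq_square)+
  have h_prod: "(\<Prod>i\<in>J. h j i (\<omega> i)) = Y (\<omega> j)" if "j \<in> J" for j \<omega>
    using J that by (simp add: h_def)
  have h_prod2: "(\<Prod>i\<in>J. h j i (\<omega> i) * h l i (\<omega> i)) = Y (\<omega> j) * Y (\<omega> l)"
    if "j \<in> J" "l \<in> J" for j l \<omega>
    using h_prod that by (simp add: prod.distrib)
  have single: "integrable ?PM (\<lambda>\<omega>. Y (\<omega> j))" "(\<integral>\<omega>. Y (\<omega> j) \<partial>?PM) = 0" if "j \<in> J" for j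
  proof -
    show "integrable ?PM (\<lambda>\<omega>. Y (\<omega> j))"
      using prod.product_integrable_prod[OF J, of "h j"] h_int h_prod[OF that] by simp
    have "(\<integral>\<omega>. Y (\<omega> j) \<partial>?PM) = (\<Prod>i\<in>J. expectation (h j i))"
      using prod.product_integral_prod[OF J, of "h j"] h_int h_prod[OF that] by simp
    also have "\<dots> = 0"
      using J that Y by (intro prod_zero bexI[of _ j]) (simp_all add: h_def)
    finally show "(\<integral>\<omega>. Y (\<omega> j) \<partial>?PM) = 0" .
  qed
  have pair: "integrable ?PM (\<lambda>\<omega>. Y (\<omega> j) * Y (\<omega> l))"
    "(\<integral>\<omega>. Y (\<omega> j) * Y (\<omega> l) \<partial>?PM) = (if j = l then expectation (\<lambda>x. (Y x)\<^sup>2) else 0)"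
    if "j \<in> J" "l \<in> J" for j l
  proof -
    show "integrable ?PM (\<lambda>\<omega>. Y (\<omega> j) * Y (\<omega> l))"
      using prod.product_integrable_prod[OF J, of "\<lambda>i x. h j i x * h l i x"] h_int2 h_prod2[OF that]
      by simp
    have "(\<integral>\<omega>. Y (\<omega> j) * Y (\<omega> l) \<partial>?PM) = (\<Prod>i\<in>J. expectation (\<lambda>x. h j i x * h l i x))"
      using prod.product_integral_prod[OF J, of "\<lambda>i x. h j i x * h l i x"] h_int2 h_prod2[OF that]
      by simp
    also have "\<dots> = (if j = l then expectation (\<lambda>x. (Y x)\<^sup>2) else 0)"
    proof (cases "j = l")
      case True
      then have "expectation (\<lambda>x. h j i x * h l i x)
          = (if i = j then expectation (\<lambda>x. (Y x)\<^sup>2) else 1)" for i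
        by (simp add: h_def power2_eq_square prob_space)
      then show ?thesis using True J that by simp
    next
      case False
      then have "expectation (\<lambda>x. h j j x * h l j x) = 0"
        using Y by (simp add: h_def)
      then show ?thesis using False J that by (simp, intro prod_zero bexI[of _ j]) simp_all
    qed
    finally show "(\<integral>\<omega>. Y (\<omega> j) * Y (\<omega> l) \<partial>?PM) = (if j = l then expectation (\<lambda>x. (Y x)\<^sup>2) else 0)" .
  qed
  show "integrable ?PM (\<lambda>\<omega>. \<Sum>j\<in>J. Y (\<omega> j))" "(\<integral>\<omega>. (\<Sum>j\<in>J. Y (\<omega> j)) \<partial>?PM) = 0"
    using single by simp_all
  have sq: "(\<Sum>j\<in>J. Y (\<omega> j))\<^sup>2 = (\<Sum>j\<in>J. \<Sum>l\<in>J. Y (\<omega> j) * Y (\<omega> l))" for \<omega>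
    by (simp add: power2_eq_square sum_product)
  show "integrable ?PM (\<lambda>\<omega>. (\<Sum>j\<in>J. Y (\<omega> j))\<^sup>2)"
    unfolding sq using pair by simp
  show "(\<integral>\<omega>. (\<Sum>j\<in>J. Y (\<omega> j))\<^sup>2 \<partial>?PM) = real (card J) * expectation (\<lambda>x. (Y x)\<^sup>2)"
    unfolding sq using pair J by simp
qed

lemma (in prob_space) batch_mean_moments:
  fixes X :: "'a \<Rightarrow> vec" and k :: nat
  assumes K: "0 < K"
    and X: "\<And>i. i < n \<Longrightarrow> integrable M (\<lambda>\<xi>. X \<xi> i)" "\<And>i. i < n \<Longrightarrow> expectation (\<lambda>\<xi>. X \<xi> i) = \<mu> i"
    and sq: "integrable M (\<lambda>\<xi>. (dist_Rn n (X \<xi>) \<mu>)\<^sup>2)" "expectation (\<lambda>\<xi>. (dist_Rn n (X \<xi>) \<mu>)\<^sup>2) \<le> \<sigma>\<^sup>2"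
  defines "v \<equiv> (\<lambda>\<omega> i. (1 / real K) * (\<Sum>j<K. X (\<omega> (k, j)) i))"
  shows "integrable (Pi\<^sub>M ({k} \<times> {..<K}) (\<lambda>_. M)) (\<lambda>\<omega>. inner_Rn n (\<lambda>i. v \<omega> i - \<mu> i) w)"
    and "(\<integral>\<omega>. inner_Rn n (\<lambda>i. v \<omega> i - \<mu> i) w \<partial>Pi\<^sub>M ({k} \<times> {..<K}) (\<lambda>_. M)) = 0"
    and "integrable (Pi\<^sub>M ({k} \<times> {..<K}) (\<lambda>_. M)) (\<lambda>\<omega>. (dist_Rn n (v \<omega>) \<mu>)\<^sup>2)"
    and "(\<integral>\<omega>. (dist_Rn n (v \<omega>) \<mu>)\<^sup>2 \<partial>Pi\<^sub>M ({k} \<times> {..<K}) (\<lambda>_. M)) \<le> \<sigma>\<^sup>2 / real K"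
proof -
  let ?J = "{k} \<times> {..<K}"
  let ?PM = "Pi\<^sub>M ?J (\<lambda>_. M)"
  define Y where "Y = (\<lambda>i \<xi>. X \<xi> i - \<mu> i)"
  have dist_Y: "(dist_Rn n (X \<xi>) \<mu>)\<^sup>2 = (\<Sum>i<n. (Y i \<xi>)\<^sup>2)" for \<xi>
    unfolding dist_Rn_def norm_Rn_sq by (simp add: inner_Rn_def Y_def power2_eq_square)
  have Y1: "integrable M (Y i)" "expectation (Y i) = 0" if "i < n" for i
    using X that by (auto simp: Y_def prob_space)
  have Y2: "integrable M (\<lambda>\<xi>. (Y i \<xi>)\<^sup>2)" if "i < n" for i
  proof (rule Bochner_Integration.integrable_bound[OF sq(1)])
    show "(\<lambda>\<xi>. (Y i \<xi>)\<^sup>2) \<in> borel_measurable M"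
      using borel_measurable_integrable[OF Y1(1)[OF that]] by measurable
    show "AE \<xi> in M. norm ((Y i \<xi>)\<^sup>2) \<le> norm ((dist_Rn n (X \<xi>) \<mu>)\<^sup>2)"
    proof (rule AE_I2)
      fix \<xi>
      have "(Y i \<xi>)\<^sup>2 \<le> (\<Sum>i<n. (Y i \<xi>)\<^sup>2)"
        by (rule member_le_sum) (use that in auto)
      then show "norm ((Y i \<xi>)\<^sup>2) \<le> norm ((dist_Rn n (X \<xi>) \<mu>)\<^sup>2)"
        by (simp add: dist_Y[symmetric])
    qed
  qed
  have fin: "finite ?J" by simp
  note mom = PiM_square_sum[OF fin Y1(1) Y2 Y1(2)]
  have v_Y: "v \<omega> i - \<mu> i = (1 / real K) * (\<Sum>p\<in>?J. Y i (\<omega> p))" for \<omega> i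
  proof -
    have "?J = Pair k ` {..<K}" by auto
    then have "(\<Sum>p\<in>?J. Y i (\<omega> p)) = (\<Sum>j<K. Y i (\<omega> (k, j)))"
      by (simp add: sum.reindex inj_on_def)
    also have "\<dots> = (\<Sum>j<K. X (\<omega> (k, j)) i) - real K * \<mu> i"
      by (simp add: Y_def sum_subtractf)
    finally show ?thesis using K by (simp add: v_def right_diff_distrib)
  qed
  have inner_v: "inner_Rn n (\<lambda>i. v \<omega> i - \<mu> i) w
      = (\<Sum>i<n. (w i / real K) * (\<Sum>p\<in>?J. Y i (\<omega> p)))" for \<omega>
    unfolding inner_Rn_def v_Y by (simp add: algebra_simps)
  have dist_v: "(dist_Rn n (v \<omega>) \<mu>)\<^sup>2 = (\<Sum>i<n. (1 / (real K)\<^sup>2) * (\<Sum>p\<in>?J. Y i (\<omega> p))\<^sup>2)" for \<omega>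
    unfolding dist_Rn_def norm_Rn_sq inner_Rn_def v_Y by (simp add: power2_eq_square)
  show "integrable ?PM (\<lambda>\<omega>. inner_Rn n (\<lambda>i. v \<omega> i - \<mu> i) w)"
    unfolding inner_v
    by (intro Bochner_Integration.integrable_sum integrable_mult_right mom(1)) auto
  show "(\<integral>\<omega>. inner_Rn n (\<lambda>i. v \<omega> i - \<mu> i) w \<partial>?PM) = 0"
    unfolding inner_v
    using mom(1,2) by (subst Bochner_Integration.integral_sum) auto
  show "integrable ?PM (\<lambda>\<omega>. (dist_Rn n (v \<omega>) \<mu>)\<^sup>2)"
    unfolding dist_v
    by (intro Bochner_Integration.integrable_sum integrable_mult_right mom(3)) auto
  have "(\<integral>\<omega>. (dist_Rn n (v \<omega>) \<mu>)\<^sup>2 \<partial>?PM)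
      = (\<Sum>i<n. (1 / (real K)\<^sup>2) * (real K * expectation (\<lambda>x. (Y i x)\<^sup>2)))"
    unfolding dist_v using mom(3,4)
    by (subst Bochner_Integration.integral_sum) (auto simp: card_cartesian_product)
  also have "\<dots> = expectation (\<lambda>\<xi>. (dist_Rn n (X \<xi>) \<mu>)\<^sup>2) / real K"
    unfolding dist_Y using K Y2
    by (subst Bochner_Integration.integral_sum)
       (auto simp: sum_divide_distrib power2_eq_square field_simps intro!: sum.cong)
  also have "\<dots> \<le> \<sigma>\<^sup>2 / real K"
    using sq(2) by (intro divide_right_mono) auto
  finally show "(\<integral>\<omega>. (dist_Rn n (v \<omega>) \<mu>)\<^sup>2 \<partial>?PM) \<le> \<sigma>\<^sup>2 / real K" .
qed

section \<open>Measurability of the iterates and of the objective\<close>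

lemma measurable_borel_RnI:
  assumes "\<And>\<omega>. \<omega> \<in> space M \<Longrightarrow> h \<omega> \<in> Rn n" and "\<And>i. (\<lambda>\<omega>. h \<omega> i) \<in> borel_measurable M"
  shows "h \<in> M \<rightarrow>\<^sub>M borel_Rn n"
  by (rule measurable_restrict_space2)
     (use assms in \<open>auto intro: measurable_coordinatewise_then_product\<close>)

lemma measurable_borel_Rn_coordinate:
  assumes "h \<in> M \<rightarrow>\<^sub>M borel_Rn n"
  shows "(\<lambda>\<omega>. h \<omega> i) \<in> borel_measurable M"
proof -
  have "h \<in> M \<rightarrow>\<^sub>M borel"
    using assms by (rule measurable_compose) (rule measurable_restrict_space1, simp)
  then show ?thesis by (rule measurable_compose) simp
qed

lemma measurable_norm_Rn:
  assumes "\<And>i. (\<lambda>\<omega>. h \<omega> i) \<in> borel_measurable M"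
  shows "(\<lambda>\<omega>. norm_Rn n (h \<omega>)) \<in> borel_measurable M"
  unfolding norm_Rn_def L2_set_def using assms by measurable

lemma measurable_clip:
  assumes [measurable]: "\<And>i. (\<lambda>\<omega>. h \<omega> i) \<in> borel_measurable M"
  shows "(\<lambda>\<omega>. clip n l (h \<omega>) i) \<in> borel_measurable M"
proof -
  note measurable_norm_Rn[of h M n, OF assms, measurable]
  have "(\<lambda>\<omega>. if norm_Rn n (h \<omega>) = 0 then 0 else min 1 (l / norm_Rn n (h \<omega>)) * h \<omega> i)
      \<in> borel_measurable M" by measurable
  also have "(\<lambda>\<omega>. if norm_Rn n (h \<omega>) = 0 then 0 else min 1 (l / norm_Rn n (h \<omega>)) * h \<omega> i)
      = (\<lambda>\<omega>. clip n l (h \<omega>) i)"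
    by (auto simp: clip_def)
  finally show ?thesis .
qed

lemma clip_Rn: "v \<in> Rn n \<Longrightarrow> clip n l v \<in> Rn n"
  by (simp add: Rn_iff clip_def)

lemma batch_grad_Rn:
  assumes "\<And>j. j < m k \<Longrightarrow> g x (\<omega> (k, j)) \<in> Rn n"
  shows "batch_grad g m \<omega> k x \<in> Rn n"
  using assms by (auto simp: Rn_iff batch_grad_def)

lemma sstm_yz_cong:
  assumes "\<And>j l. j < k \<Longrightarrow> l < m j \<Longrightarrow> \<omega> (j, l) = \<omega>' (j, l)"
  shows "sstm_yz n \<nu> m \<alpha> B g x0 \<omega> k = sstm_yz n \<nu> m \<alpha> B g x0 \<omega>' k"
  using assms
proof (induction k)
  case (Suc k)
  then have "batch_grad g m \<omega> k x = batch_grad g m \<omega>' k x" for x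
    by (auto simp: batch_grad_def intro!: sum.cong)
  with Suc show ?case by simp
qed simp

lemma space_sample_spaceD:
  "\<lbrakk>\<omega> \<in> space (sample_space K m P); k < K; j < m k\<rbrakk> \<Longrightarrow> \<omega> (k, j) \<in> space P"
  by (auto simp: sample_space_def space_PiM)

lemma sstm_yz_Rn:
  assumes g: "(\<lambda>(x, \<xi>). g x \<xi>) \<in> borel_Rn n \<Otimes>\<^sub>M P \<rightarrow>\<^sub>M borel_Rn n"
    and x0: "x0 \<in> Rn n" and "k \<le> K" and \<omega>: "\<omega> \<in> space (sample_space K m P)"
  shows "fst (sstm_yz n \<nu> m \<alpha> B g x0 \<omega> k) \<in> Rn n \<and> snd (sstm_yz n \<nu> m \<alpha> B g x0 \<omega> k) \<in> Rn n"
  using \<open>k \<le> K\<close>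
proof (induction k)
  case (Suc k)
  obtain y z where yz: "sstm_yz n \<nu> m \<alpha> B g x0 \<omega> k = (y, z)" by fastforce
  have y: "y \<in> Rn n" "z \<in> Rn n" using Suc yz by auto
  have "g x (\<omega> (k, j)) \<in> Rn n" if "x \<in> Rn n" "j < m k" for x j
    using measurable_space[OF g, of "(x, \<omega> (k, j))"] that space_sample_spaceD[OF \<omega>, of k j] Suc.prems
    by (auto simp: space_pair_measure space_restrict_space)
  then have G: "clip n l (batch_grad g m \<omega> k x) \<in> Rn n" if "x \<in> Rn n" for x l
    using that by (intro clip_Rn batch_grad_Rn)
  show ?case
    using y G[OF Rn_combination[OF y]] by (auto simp: yz Let_def Rn_iff)
qed (simp add: x0)

lemma sstm_yz_measurable:
  assumes g: "(\<lambda>(x, \<xi>). g x \<xi>) \<in> borel_Rn n \<Otimes>\<^sub>M P \<rightarrow>\<^sub>M borel_Rn n"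
    and x0: "x0 \<in> Rn n" and "k \<le> K"
  shows "(\<lambda>\<omega>. fst (sstm_yz n \<nu> m \<alpha> B g x0 \<omega> k)) \<in> sample_space K m P \<rightarrow>\<^sub>M borel_Rn n \<and>
    (\<lambda>\<omega>. snd (sstm_yz n \<nu> m \<alpha> B g x0 \<omega> k)) \<in> sample_space K m P \<rightarrow>\<^sub>M borel_Rn n"
  using \<open>k \<le> K\<close>
proof (induction k)
  case 0
  then show ?case by (auto intro!: measurable_borel_RnI simp: x0)
next
  case (Suc k)
  let ?S = "sample_space K m P"
  define y where "y = (\<lambda>\<omega>. fst (sstm_yz n \<nu> m \<alpha> B g x0 \<omega> k))"
  define z where "z = (\<lambda>\<omega>. snd (sstm_yz n \<nu> m \<alpha> B g x0 \<omega> k))"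
  define A a A' where "A = sstm_A \<nu> \<alpha> k" and "a = sstm_alpha \<nu> \<alpha> (Suc k)" and "A' = sstm_A \<nu> \<alpha> (Suc k)"
  define x where "x = (\<lambda>\<omega> i. (A * y \<omega> i + a * z \<omega> i) / A')"
  define G where "G = (\<lambda>\<omega>. clip n (B / a) (batch_grad g m \<omega> k (x \<omega>)))"
  have y: "y \<in> ?S \<rightarrow>\<^sub>M borel_Rn n" and z: "z \<in> ?S \<rightarrow>\<^sub>M borel_Rn n"
    using Suc by (auto simp: y_def z_def)
  note [measurable] = measurable_borel_Rn_coordinate[OF y] measurable_borel_Rn_coordinate[OF z]
  have yzR: "y \<omega> \<in> Rn n" "z \<omega> \<in> Rn n" if "\<omega> \<in> space ?S" for \<omega>
    using measurable_space[OF y that] measurable_space[OF z that] by (auto simp: space_restrict_space)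
  have x: "x \<in> ?S \<rightarrow>\<^sub>M borel_Rn n"
    by (rule measurable_borel_RnI) (auto simp: x_def intro!: Rn_combination yzR)
  have gx: "(\<lambda>\<omega>. g (x \<omega>) (\<omega> (k, j))) \<in> ?S \<rightarrow>\<^sub>M borel_Rn n" if "j < m k" for j
  proof -
    have "(\<lambda>\<omega>. \<omega> (k, j)) \<in> ?S \<rightarrow>\<^sub>M P"
      unfolding sample_space_def using that Suc.prems
      by (intro measurable_component_singleton) auto
    then have "(\<lambda>\<omega>. (x \<omega>, \<omega> (k, j))) \<in> ?S \<rightarrow>\<^sub>M borel_Rn n \<Otimes>\<^sub>M P"
      using x by (rule measurable_Pair[rotated])
    from measurable_compose[OF this g] show ?thesis by simp
  qed
  have b: "(\<lambda>\<omega>. batch_grad g m \<omega> k (x \<omega>) i) \<in> borel_measurable ?S" for i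
    unfolding batch_grad_def
    by (intro borel_measurable_times borel_measurable_sum measurable_borel_Rn_coordinate[OF gx]) auto
  have [measurable]: "(\<lambda>\<omega>. G \<omega> i) \<in> borel_measurable ?S" for i
    unfolding G_def by (rule measurable_clip[OF b])
  have step: "sstm_yz n \<nu> m \<alpha> B g x0 \<omega> (Suc k)
      = ((\<lambda>i. (A * y \<omega> i + a * (z \<omega> i - a * G \<omega> i)) / A'), (\<lambda>i. z \<omega> i - a * G \<omega> i))" for \<omega>
    by (simp add: y_def z_def A_def a_def A'_def x_def G_def Let_def case_prod_beta)
  show ?case
    using sstm_yz_Rn[OF g x0 Suc.prems, of _ m \<nu> \<alpha> B] unfolding step
    by (auto intro!: measurable_borel_RnI)
qed

lemma dist_Rn_measurable:
  assumes "h \<in> M \<rightarrow>\<^sub>M borel_Rn n"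
  shows "(\<lambda>\<omega>. dist_Rn n (h \<omega>) c) \<in> borel_measurable M"
  unfolding dist_Rn_def
  by (rule measurable_norm_Rn)
     (intro borel_measurable_diff measurable_borel_Rn_coordinate[OF assms] borel_measurable_const)

context holder_problem
begin

text \<open>
With a subgradient at every point, \<open>f\<close> is the supremum of its affine minorants, so its strict
superlevel sets are unions of open half spaces.
\<close>
lemma f_measurable: "f \<in> borel_measurable (borel_Rn n)"
proof (subst borel_measurable_iff_greater, rule allI)
  fix c
  let ?U = "\<lambda>x. {y. c < f x + inner_Rn n (df x) (\<lambda>i. y i - x i)}"
  have "open (?U x)" for x
    unfolding inner_Rn_def
    by (intro open_Collect_less continuous_intros continuous_on_product_coordinates)
  then have "open (\<Union>x\<in>Rn n. ?U x)" by (intro open_UN) auto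
  then have "Rn n \<inter> (\<Union>x\<in>Rn n. ?U x) \<in> sets (borel_Rn n)"
    by (auto simp: sets_restrict_space)
  also have "Rn n \<inter> (\<Union>x\<in>Rn n. ?U x) = {y \<in> Rn n. c < f y}"
  proof (intro equalityI subsetI)
    fix y assume "y \<in> Rn n \<inter> (\<Union>x\<in>Rn n. ?U x)"
    then show "y \<in> {y \<in> Rn n. c < f y}" using subgradient_le by fastforce
  next
    fix y assume "y \<in> {y \<in> Rn n. c < f y}"
    then show "y \<in> Rn n \<inter> (\<Union>x\<in>Rn n. ?U x)" by (auto simp: inner_Rn_def intro!: bexI[of _ y])
  qed
  finally show "{w \<in> space (borel_Rn n). c < f w} \<in> sets (borel_Rn n)"
    by (simp add: space_restrict_space)
qed

end

section \<open>The parameter schedule\<close>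

text \<open>
\<open>L\<close> stands for the logarithmic factor. The two lower bounds on \<open>N\<close> serve different purposes: the first
keeps gradients below the clipping level, the second yields the accelerated rate. The step
size is as large as \<open>\<alpha> N\<^bsup>(1+3\<nu>)/(1+\<nu>)\<^esup> = 4 R\<^sub>0\<^sup>2 / \<epsilon>\<close> demands, since \<open>A\<^sub>N\<close> is at least half of
the left-hand side.
\<close>
locale sstm_schedule =
  fixes \<nu> M R0 \<epsilon> L :: real and N :: nat and \<alpha> B :: real
  assumes \<nu>: "0 \<le> \<nu>" "\<nu> \<le> 1"
    and M: "0 < M"
    and R0: "0 < R0"
    and \<epsilon>: "0 < \<epsilon>"
    and L: "1 \<le> L"
    and N: "1 \<le> N"
    and B_eq: "B = R0 / (12 * L)"
    and \<alpha>_eq: "\<alpha> = 4 * R0\<^sup>2 / (\<epsilon> * real N powr ((1 + 3 * \<nu>) / (1 + \<nu>)))"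
    and N_large: "1536 * L * (M * R0 powr (1 + \<nu>) / \<epsilon>) powr (1 / (1 + \<nu>)) \<le> real N"
    and N_accel: "256 * (M * R0 powr (1 + \<nu>) / \<epsilon>) powr (2 / (1 + \<nu>))
      \<le> real N powr ((1 + 3 * \<nu>) / (1 + \<nu>))"
begin

abbreviation a :: "nat \<Rightarrow> real" where "a \<equiv> sstm_alpha \<nu> \<alpha>"
abbreviation A :: "nat \<Rightarrow> real" where "A \<equiv> sstm_A \<nu> \<alpha>"

definition s :: real where "s = 2 * \<nu> / (1 + \<nu>)"

lemma s_bounds: "0 \<le> s" "s \<le> 1"
  using \<nu> by (auto simp: s_def field_simps)

lemma one_plus_s: "(1 + 3 * \<nu>) / (1 + \<nu>) = 1 + s"
  using \<nu> by (simp add: s_def field_simps)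

lemma \<alpha>_eq_s: "\<alpha> = 4 * R0\<^sup>2 / (\<epsilon> * real N powr (1 + s))"
  using \<alpha>_eq unfolding one_plus_s .

lemma \<alpha>_pos: "0 < \<alpha>"
  using R0 \<epsilon> N by (simp add: \<alpha>_eq)

lemma B_pos: "0 < B" and B_le: "B \<le> R0"
proof -
  show "0 < B" using R0 L by (simp add: B_eq)
  have "R0 * 1 \<le> R0 * (12 * L)" using R0 L by (intro mult_left_mono) auto
  then show "B \<le> R0" using L by (simp add: B_eq field_simps)
qed

lemma a_Suc: "a (Suc k) = \<alpha> * real (Suc k) powr s"
  by (simp add: sstm_alpha_def s_def)

lemma a_pos: "0 < a (Suc k)"
  using \<alpha>_pos by (simp add: a_Suc)

lemma A_0 [simp]: "A 0 = 0"
  by (simp add: sstm_A_def sstm_alpha_def)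

lemma A_Suc: "A (Suc k) = A k + a (Suc k)"
  by (simp add: sstm_A_def)

lemma A_nonneg: "0 \<le> A k"
  by (induction k) (use a_pos in \<open>auto simp: A_Suc add_nonneg_nonneg less_imp_le\<close>)

lemma A_upper: "A k \<le> \<alpha> * (real k * real k powr s)"
proof (induction k)
  case (Suc k)
  have "real k * real k powr s \<le> real k * real (Suc k) powr s"
    using s_bounds by (intro mult_left_mono powr_mono2) auto
  then have "A k \<le> \<alpha> * (real k * real (Suc k) powr s)"
    using Suc \<alpha>_pos by (smt (verit) mult_left_mono)
  then show ?case by (simp add: A_Suc a_Suc algebra_simps)
qed simp

lemma A_lower: "\<alpha> * real k powr (1 + s) / 2 \<le> A k"
proof (cases "k = 0")
  case False
  \<comment> \<open>as \<open>s \<le> 1\<close>, the weights are above the chord from 0 to \<open>k\<close>, so their sum is at least a triangle\<close>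
  have le_a: "\<alpha> * real k powr s * (real j / real k) \<le> a j" if "j \<le> k" for j
  proof (cases j)
    case 0
    then show ?thesis by (simp add: sstm_alpha_def)
  next
    case (Suc i)
    have "real j / real k = (real j / real k) powr 1"
      using Suc False by simp
    also have "\<dots> \<le> (real j / real k) powr s"
      using that Suc s_bounds by (intro powr_mono') auto
    finally have "\<alpha> * real k powr s * (real j / real k) \<le> \<alpha> * real k powr s * (real j / real k) powr s"
      using \<alpha>_pos by (intro mult_left_mono) auto
    also have "\<dots> = \<alpha> * real j powr s"
      using False by (simp add: powr_divide)
    finally show ?thesis using Suc a_Suc by simp
  qed
  have gauss: "(\<Sum>j\<le>k. real j) = real k * (real k + 1) / 2"
    by (induction k) (auto simp: field_simps)
  have "\<alpha> * real k powr (1 + s) / 2 \<le> \<alpha> * real k powr s * ((real k + 1) / 2)"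
    using \<alpha>_pos False by (simp add: powr_add algebra_simps)
  also have "\<dots> = (\<Sum>j\<le>k. \<alpha> * real k powr s * (real j / real k))"
    unfolding sum_distrib_left[symmetric] sum_divide_distrib[symmetric] gauss using False by simp
  also have "\<dots> \<le> A k"
    unfolding sstm_A_def by (intro sum_mono le_a) auto
  finally show ?thesis .
qed simp

lemma a_over_A: "a (Suc k) / A (Suc k) \<le> 2 / real (Suc k)"
proof -
  have "a (Suc k) * real (Suc k) / 2 = \<alpha> * real (Suc k) powr (1 + s) / 2"
    by (simp add: a_Suc powr_add algebra_simps)
  also have "\<dots> \<le> A (Suc k)" by (rule A_lower)
  finally have "a (Suc k) * real (Suc k) \<le> 2 * A (Suc k)" by simp
  moreover have "0 < A (Suc k)" using A_nonneg[of k] a_pos[of k] by (simp add: A_Suc)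
  ultimately show ?thesis by (simp add: field_simps)
qed

lemma A_N: "2 * R0\<^sup>2 \<le> \<epsilon> * A N"
proof -
  have "2 * R0\<^sup>2 = \<epsilon> * (\<alpha> * real N powr (1 + s) / 2)"
    using \<epsilon> N by (simp add: \<alpha>_eq_s)
  also have "\<dots> \<le> \<epsilon> * A N"
    using \<epsilon> A_lower by (intro mult_left_mono) auto
  finally show ?thesis .
qed

text \<open>
The threshold for \<open>power_holder_split\<close> in iteration \<open>k\<close>. It is the solution of
\<open>M \<tau>\<^bsup>1+\<nu>\<^esup> = \<epsilon> / (8 k)\<close>, which makes the error of an iteration \<open>\<epsilon> A\<^sub>k / (8 k)\<close>.
\<close>
definition \<tau> :: "nat \<Rightarrow> real" where
  "\<tau> k = (\<epsilon> / (8 * M * real k)) powr (1 / (1 + \<nu>))"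

lemma \<tau>_pos: "0 < k \<Longrightarrow> 0 < \<tau> k"
  using \<epsilon> M by (simp add: \<tau>_def)

text \<open>
The powers of the iteration number cancel: by \<open>a_over_A\<close> the left-hand side is at most
\<open>2 M \<alpha> (8 M / \<epsilon>)\<^bsup>(1-\<nu>)/(1+\<nu>)\<^esup>\<close>, and the lower bound \<open>N_accel\<close> is what makes \<open>\<alpha>\<close> small enough.
\<close>
lemma stepsize_accel: "M * ((a (Suc k))\<^sup>2 / A (Suc k)) * \<tau> (Suc k) powr (\<nu> - 1) \<le> 1 / 4"
proof -
  let ?K = "real (Suc k)"
  define b where "b = (1 - \<nu>) / (1 + \<nu>)"
  have b: "1 + b = 2 / (1 + \<nu>)" "s + b = 1" "0 \<le> b"
  proof -
    have "1 + b = (1 + \<nu>) / (1 + \<nu>) + (1 - \<nu>) / (1 + \<nu>)" using \<nu> by (simp add: b_def)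
    then show "1 + b = 2 / (1 + \<nu>)" unfolding add_divide_distrib[symmetric] by simp
    have "s + b = (2 * \<nu> + (1 - \<nu>)) / (1 + \<nu>)"
      unfolding b_def s_def add_divide_distrib[symmetric] by simp
    then show "s + b = 1" using \<nu> by simp
    show "0 \<le> b" using \<nu> by (simp add: b_def)
  qed
  have "1 / (1 + \<nu>) * (\<nu> - 1) = - b" by (simp add: b_def minus_divide_left)
  then have \<tau>: "\<tau> (Suc k) powr (\<nu> - 1) = (8 * M / \<epsilon>) powr b * ?K powr b"
    using M \<epsilon> by (simp add: \<tau>_def powr_powr powr_minus_divide powr_divide powr_mult)
  have "M * ((a (Suc k))\<^sup>2 / A (Suc k)) * \<tau> (Suc k) powr (\<nu> - 1)
      = M * a (Suc k) * ((8 * M / \<epsilon>) powr b * ?K powr b) * (a (Suc k) / A (Suc k))"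
    by (simp add: \<tau> power2_eq_square)
  also have "\<dots> \<le> M * a (Suc k) * ((8 * M / \<epsilon>) powr b * ?K powr b) * (2 / ?K)"
    using a_pos[of k] M by (intro mult_left_mono a_over_A) auto
  also have "\<dots> = 2 * M * \<alpha> * (8 * M / \<epsilon>) powr b * (?K powr (s + b) / ?K)"
    by (simp add: a_Suc powr_add)
  also have "\<dots> = 2 * M * \<alpha> * (8 * M / \<epsilon>) powr b"
    using b by simp
  also have "\<dots> \<le> 1 / 4"
  proof -
    have R: "R0\<^sup>2 = (R0 powr (1 + \<nu>)) powr (2 / (1 + \<nu>))"
    proof -
      have "(1 + \<nu>) * (2 / (1 + \<nu>)) = 2"
        unfolding times_divide_eq_right
        by (rule nonzero_mult_div_cancel_left) (use \<nu> in auto)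
      then show ?thesis unfolding powr_powr using R0 by simp
    qed
    have "4 * (8 * M / \<epsilon>) powr (1 + b) * R0\<^sup>2
        = 4 * 8 powr (1 + b) * (M * R0 powr (1 + \<nu>) / \<epsilon>) powr (2 / (1 + \<nu>))"
      unfolding R b(1) using M \<epsilon> R0 by (simp add: powr_mult powr_divide)
    also have "\<dots> \<le> 256 * (M * R0 powr (1 + \<nu>) / \<epsilon>) powr (2 / (1 + \<nu>))"
    proof (rule mult_right_mono)
      have "(8::real) powr (1 + b) \<le> 8 powr 2"
        using b s_bounds by (intro powr_mono) auto
      then show "4 * 8 powr (1 + b) \<le> (256::real)" by simp
    qed simp
    finally have "4 * (8 * M / \<epsilon>) powr (1 + b) * R0\<^sup>2 \<le> real N powr (1 + s)"
      using N_accel unfolding one_plus_s by linarith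
    moreover have "2 * M * \<alpha> * (8 * M / \<epsilon>) powr b = (8 * M / \<epsilon>) powr (1 + b) * R0\<^sup>2 / real N powr (1 + s)"
      using M \<epsilon> by (simp add: \<alpha>_eq_s powr_add field_simps)
    moreover have "0 < real N powr (1 + s)" using N by simp
    ultimately show ?thesis by (simp only: pos_divide_le_eq)
  qed
  finally show ?thesis .
qed

definition err :: "nat \<Rightarrow> real" where
  "err k = A (Suc k) * M * \<tau> (Suc k) powr (1 + \<nu>)"

lemma sum_err: "(\<Sum>k<N. err k) \<le> R0\<^sup>2 / 2"
proof -
  have "err k \<le> R0\<^sup>2 / (2 * real N)" if "k < N" for k
  proof -
    let ?K = "real (Suc k)"
    have "\<tau> (Suc k) powr (1 + \<nu>) = \<epsilon> / (8 * M * ?K)"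
      unfolding \<tau>_def powr_powr using \<nu> M \<epsilon> by simp
    then have "err k = A (Suc k) * (\<epsilon> / (8 * ?K))" using M by (simp add: err_def)
    also have "\<dots> \<le> \<alpha> * (?K * ?K powr s) * (\<epsilon> / (8 * ?K))"
      using \<epsilon> by (intro mult_right_mono A_upper) auto
    also have "\<dots> = \<alpha> * \<epsilon> / 8 * ?K powr s" by (simp add: field_simps)
    also have "\<dots> \<le> \<alpha> * \<epsilon> / 8 * real N powr s"
      using that \<alpha>_pos \<epsilon> s_bounds by (intro mult_left_mono powr_mono2) auto
    also have "\<dots> = R0\<^sup>2 / (2 * real N)"
      using \<epsilon> N by (simp add: \<alpha>_eq_s powr_add)
    finally show ?thesis .
  qed
  then have "(\<Sum>k<N. err k) \<le> (\<Sum>k<N. R0\<^sup>2 / (2 * real N))" by (intro sum_mono) auto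
  also have "\<dots> = R0\<^sup>2 / 2" using N by simp
  finally show ?thesis .
qed

text \<open>
Together with the next lemma, this keeps \<open>\<nabla>f(x)\<close> at most half the clipping level. Here the part
\<open>\<nabla>f(x) - \<nabla>f(y)\<close> is treated, where \<open>x\<close> is within \<open>8 R\<^sub>0 / (k + 1)\<close> of \<open>y\<close>. The bound grows with the
iteration like a power with exponent \<open>s - \<nu> \<ge> 0\<close> and is therefore worst at \<open>N\<close>.
\<close>
lemma far_gradient_unclipped:
  assumes "k < N"
  shows "a (Suc k) * (M * (8 * R0 / real (Suc k)) powr \<nu>) \<le> B / 4"
proof -
  let ?K = "real (Suc k)"
  define X where "X = M * R0 powr (1 + \<nu>) / \<epsilon>"
  have "\<nu> * \<nu> \<le> \<nu>" using \<nu> by (simp add: mult_left_le)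
  then have sn: "0 \<le> s - \<nu>" using \<nu> by (simp add: s_def field_simps)
  have X: "0 < X" using M R0 \<epsilon> by (simp add: X_def)
  have "1536 * L * X \<le> (1536 * L) powr (1 + \<nu>) * X"
    using L \<nu> powr_mono[of 1 "1 + \<nu>" "1536 * L"] X by (intro mult_right_mono) auto
  also have "\<dots> = (1536 * L * X powr (1 / (1 + \<nu>))) powr (1 + \<nu>)"
    using L \<nu> X by (simp add: powr_mult powr_powr)
  also have "\<dots> \<le> real N powr (1 + \<nu>)"
    using L \<nu> by (intro powr_mono2 N_large[folded X_def]) auto
  finally have NX: "1536 * L * X \<le> real N powr (1 + \<nu>)" .
  have "a (Suc k) * (M * (8 * R0 / ?K) powr \<nu>) = \<alpha> * M * R0 powr \<nu> * (8 powr \<nu> * ?K powr (s - \<nu>))"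
    using R0 by (simp add: a_Suc powr_divide powr_mult powr_diff)
  also have "\<dots> \<le> \<alpha> * M * R0 powr \<nu> * (8 * real N powr (s - \<nu>))"
  proof (intro mult_left_mono mult_mono powr_mono2)
    show "8 powr \<nu> \<le> (8::real)" using \<nu> powr_mono[of \<nu> 1 "8::real"] by simp
  qed (use assms sn \<alpha>_pos M in auto)
  also have "\<dots> = 32 * X * R0 / real N powr (1 + \<nu>)"
    using N R0 \<epsilon> by (simp add: X_def \<alpha>_eq_s powr_add powr_diff power2_eq_square field_simps)
  also have "\<dots> \<le> B / 4"
    using mult_right_mono[OF NX, of R0] N R0 L \<epsilon> by (simp add: B_eq field_simps)
  finally show ?thesis .
qed

text \<open>
The part \<open>\<nabla>f(y)\<close>, bounded through \<open>norm_df_le_gap\<close> by the gap \<open>2 R\<^sub>0\<^sup>2 / A\<^sub>k\<close> that the energy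
guarantees. Again the worst case is \<open>N\<close>, where all powers combine to \<open>32 X\<^bsup>1/(1+\<nu>)\<^esup> R\<^sub>0 / N\<close>.
\<close>
lemma near_gradient_unclipped:
  assumes "k < N" "0 < k"
  shows "a (Suc k) * (2 * M powr (1 / (1 + \<nu>)) * (2 * R0\<^sup>2 / A k) powr (\<nu> / (1 + \<nu>))) \<le> B / 4"
proof -
  let ?K = "real (Suc k)"
  define X where "X = M * R0 powr (1 + \<nu>) / \<epsilon>"
  define t where "t = 1 / (1 + \<nu>)"
  have t: "s = 2 - 2 * t" "\<nu> / (1 + \<nu>) = s / 2" "(1 + \<nu>) * t = 1" "0 < t" "t \<le> 1"
    using \<nu> by (auto simp: t_def s_def field_simps)
  have "?K powr (1 + s) \<le> (2 * real k) powr (1 + s)"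
    using assms s_bounds by (intro powr_mono2) auto
  also have "\<dots> = 2 powr (1 + s) * real k powr (1 + s)" by (simp add: powr_mult)
  also have "\<dots> \<le> 4 * real k powr (1 + s)"
    using s_bounds powr_mono[of "1 + s" 2 "2::real"] by (intro mult_right_mono) auto
  finally have "\<alpha> * ?K powr (1 + s) \<le> \<alpha> * (4 * real k powr (1 + s))"
    using \<alpha>_pos by (intro mult_left_mono) auto
  then have A: "\<alpha> * ?K powr (1 + s) / 8 \<le> A k" using A_lower[of k] by simp
  have "2 * R0\<^sup>2 / A k \<le> 2 * R0\<^sup>2 / (\<alpha> * ?K powr (1 + s) / 8)"
    using A \<alpha>_pos by (intro divide_left_mono mult_pos_pos less_le_trans[OF _ A]) auto
  also have "\<dots> = 16 * R0\<^sup>2 / (\<alpha> * ?K powr (1 + s))" by simp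
  finally have "(2 * R0\<^sup>2 / A k) powr (s / 2) \<le> (16 * R0\<^sup>2 / (\<alpha> * ?K powr (1 + s))) powr (s / 2)"
    using s_bounds A_nonneg[of k] by (intro powr_mono2) auto
  also have "\<dots> = 16 powr (s / 2) * (R0\<^sup>2 / (\<alpha> * ?K powr (1 + s))) powr (s / 2)"
    using R0 \<alpha>_pos by (subst powr_mult[symmetric]) auto
  also have "\<dots> \<le> 4 * (R0\<^sup>2 / (\<alpha> * ?K powr (1 + s))) powr (s / 2)"
  proof (rule mult_right_mono)
    have "(16::real) powr (s / 2) \<le> 16 powr (1 / 2)"
      using s_bounds by (intro powr_mono) auto
    also have "\<dots> = 4" by (simp add: powr_half_sqrt)
    finally show "(16::real) powr (s / 2) \<le> 4" .
  qed simp
  finally have "a (Suc k) * (2 * M powr t * (2 * R0\<^sup>2 / A k) powr (s / 2))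
      \<le> a (Suc k) * (2 * M powr t * (4 * (R0\<^sup>2 / (\<alpha> * ?K powr (1 + s))) powr (s / 2)))"
    using a_pos[of k] by (intro mult_left_mono) auto
  also have "\<dots> = 8 * M powr t * R0 powr s * \<alpha> powr t * ?K powr (s * (1 - s) / 2)"
  proof -
    have "t = 1 - s / 2" using t(1) by (simp add: field_simps)
    then have "\<alpha> powr t = \<alpha> / \<alpha> powr (s / 2)"
      using \<alpha>_pos by (simp add: powr_diff)
    moreover have "?K powr (s * (1 - s) / 2) = ?K powr s / ?K powr ((1 + s) * (s / 2))"
      unfolding powr_diff[symmetric] by (rule arg_cong[where f = "\<lambda>e. ?K powr e"]) (simp add: field_simps)
    moreover have "(R0\<^sup>2) powr (s / 2) = R0 powr s"
      using R0 by (simp add: powr_powr flip: powr_numeral)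
    ultimately show ?thesis
      using R0 \<alpha>_pos by (simp add: a_Suc powr_divide powr_mult powr_powr)
  qed
  also have "\<dots> \<le> 8 * M powr t * R0 powr s * \<alpha> powr t * real N powr (s * (1 - s) / 2)"
    using assms s_bounds by (intro mult_left_mono powr_mono2) auto
  also have "\<dots> = 8 * 4 powr t * X powr t * R0 / real N"
  proof -
    \<comment> \<open>in logarithms the identity between powers is linear, with \<open>(1 + \<nu>) * t = 1\<close>\<close>
    have ln_\<alpha>: "ln \<alpha> = ln 4 + 2 * ln R0 - ln \<epsilon> - (1 + s) * ln (real N)"
      using R0 \<epsilon> N unfolding \<alpha>_eq_s power2_eq_square by (simp add: ln_mult ln_div ln_powr)
    have ln_X: "ln X = ln M + (1 + \<nu>) * ln R0 - ln \<epsilon>"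
      using M R0 \<epsilon> by (simp add: X_def ln_mult ln_div ln_powr)
    have X: "0 < X" using M R0 \<epsilon> by (simp add: X_def)
    have "ln (M powr t * R0 powr s * \<alpha> powr t * real N powr (s * (1 - s) / 2))
        = t * ln M + s * ln R0 + t * ln \<alpha> + s * (1 - s) / 2 * ln (real N)"
      using M R0 \<alpha>_pos N by (simp add: ln_mult ln_powr)
    also have "\<dots> = t * ln 4 + t * (ln M + (1 + \<nu>) * ln R0 - ln \<epsilon>) + ln R0 - ln (real N)"
    proof -
      have "t * ((1 + \<nu>) * ln R0) = ln R0" using t(3) by (simp add: mult.assoc[symmetric] mult.commute)
      then show ?thesis unfolding ln_\<alpha> t(1) by (simp add: field_simps)
    qed
    also have "\<dots> = ln (4 powr t * X powr t * R0 / real N)"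
      unfolding ln_X[symmetric] using X R0 N by (simp add: ln_mult ln_div ln_powr del: times_divide_eq_right)
    finally have "M powr t * R0 powr s * \<alpha> powr t * real N powr (s * (1 - s) / 2)
        = 4 powr t * X powr t * R0 / real N"
      using M R0 \<alpha>_pos N X by (subst (asm) ln_inj_iff) auto
    then show ?thesis by simp
  qed
  also have "\<dots> \<le> 8 * 4 * X powr t * R0 / real N"
    using powr_mono[of t 1 "4::real"] t R0 by (intro divide_right_mono mult_right_mono) auto
  also have "\<dots> \<le> B / 4"
    using mult_right_mono[OF N_large, of R0] N R0 L
    by (simp add: B_eq field_simps t_def X_def)
  finally show ?thesis by (simp add: t_def t(2))
qed

end

section \<open>The exponential supermartingale\<close>

locale clipped_sstm = holder_problem n \<nu> M R0 f df xs + sstm_schedule \<nu> M R0 \<epsilon> L N \<alpha> B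
  for n :: nat and \<nu> M R0 :: real and f :: "vec \<Rightarrow> real" and df :: "vec \<Rightarrow> vec" and xs :: vec
    and \<epsilon> L :: real and N :: nat and \<alpha> B :: real +
  fixes \<sigma> :: real and m :: "nat \<Rightarrow> nat" and P :: "'xi measure" and g :: "vec \<Rightarrow> 'xi \<Rightarrow> vec" and x0 :: vec
  assumes m_pos: "k < N \<Longrightarrow> 1 \<le> m k"
    and m_large: "k < N \<Longrightarrow> (a (Suc k))\<^sup>2 * \<sigma>\<^sup>2 * real N / (B\<^sup>2 * L) \<le> real (m k)"
    and sampling: "oracle_cond n \<sigma> (cball_Rn n xs (3 * R0)) df P g"
    and x0: "x0 \<in> Rn n" "dist_Rn n x0 xs \<le> R0"
begin

abbreviation yz :: "nat \<Rightarrow> (nat \<times> nat \<Rightarrow> 'xi) \<Rightarrow> vec \<times> vec" where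
  "yz k \<omega> \<equiv> sstm_yz n \<nu> m \<alpha> B g x0 \<omega> k"

definition query :: "nat \<Rightarrow> vec \<times> vec \<Rightarrow> vec" where
  "query k p = (\<lambda>i. (A k * fst p i + a (Suc k) * snd p i) / A (Suc k))"

definition advance :: "nat \<Rightarrow> vec \<Rightarrow> vec \<times> vec \<Rightarrow> vec \<times> vec" where
  "advance k v p =
    (let z' = (\<lambda>i. snd p i - a (Suc k) * clip n (B / a (Suc k)) v i)
     in ((\<lambda>i. (A k * fst p i + a (Suc k) * z' i) / A (Suc k)), z'))"

lemma yz_Suc: "yz (Suc k) \<omega> = advance k (batch_grad g m \<omega> k (query k (yz k \<omega>))) (yz k \<omega>)"
  by (simp add: advance_def query_def Let_def case_prod_beta)

definition energy :: "nat \<Rightarrow> vec \<times> vec \<Rightarrow> real" where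
  "energy k p = A k * (f (fst p) - f xs) + (dist_Rn n (snd p) xs)\<^sup>2 / 2"

text \<open>
The energy controls \<open>z\<close> but not the distance of \<open>y\<close> to the minimizer. That distance is inherited from
the past, since \<open>y\<close> is an average of earlier \<open>z\<close>, and is carried along as an invariant.
\<close>
definition near :: "vec \<times> vec \<Rightarrow> bool" where
  "near p \<longleftrightarrow> fst p \<in> Rn n \<and> snd p \<in> Rn n \<and>
    dist_Rn n (fst p) xs \<le> 2 * R0 \<and> dist_Rn n (snd p) xs \<le> 2 * R0"

lemma A_Suc_pos: "0 < A k + a (Suc k)"
  using A_nonneg[of k] a_pos[of k] by simp

lemma query_near:
  assumes "near p"
  shows "query k p \<in> Rn n" "dist_Rn n (query k p) xs \<le> 2 * R0"
  using assms A_nonneg[of k] a_pos[of k] A_Suc_pos[of k]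
  by (auto simp: near_def query_def A_Suc less_imp_le intro!: Rn_combination dist_Rn_combination)

lemma two_R0_Q: "\<lbrakk>x \<in> Rn n; dist_Rn n x xs \<le> 2 * R0\<rbrakk> \<Longrightarrow> x \<in> Q"
  using R0 by (intro in_QI) auto

lemma gradient_unclipped:
  assumes k: "k < N" and p: "near p" and energy: "energy k p \<le> 2 * R0\<^sup>2"
  shows "norm_Rn n (df (query k p)) \<le> B / a (Suc k) / 2"
proof -
  let ?x = "query k p" and ?y = "fst p" and ?z = "snd p" and ?K = "real (Suc k)"
  have xQ: "?x \<in> Q" and yQ: "?y \<in> Q"
    using query_near[OF p] p by (auto intro!: two_R0_Q simp: near_def)
  have "a (Suc k) * norm_Rn n (df ?x) \<le> B / 2"
  proof (cases "k = 0")
    case True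
    have "norm_Rn n (df ?x) \<le> M * dist_Rn n ?x xs powr \<nu>"
      by (rule norm_df_le_dist[OF xQ])
    also have "\<dots> \<le> M * (8 * R0 / ?K) powr \<nu>"
      using True query_near[OF p, of k] M R0 \<nu> by (intro mult_left_mono powr_mono2) auto
    finally have "a (Suc k) * norm_Rn n (df ?x) \<le> a (Suc k) * (M * (8 * R0 / ?K) powr \<nu>)"
      using a_pos[of k] by (intro mult_left_mono) auto
    also have "\<dots> \<le> B / 4" by (rule far_gradient_unclipped[OF k])
    finally show ?thesis using B_pos by simp
  next
    case False
    have Ak: "0 < A k" using False A_Suc_pos[of "k - 1"] A_Suc[of "k - 1"] by simp
    have "(\<lambda>i. ?x i - ?y i) = (\<lambda>i. (a (Suc k) / A (Suc k)) * (?z i - ?y i))"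
    proof
      fix i
      have "?x i - ?y i = (A k * ?y i + a (Suc k) * ?z i - A (Suc k) * ?y i) / A (Suc k)"
        using A_Suc_pos[of k] by (simp add: query_def A_Suc diff_divide_distrib)
      then show "?x i - ?y i = (a (Suc k) / A (Suc k)) * (?z i - ?y i)"
        by (simp add: A_Suc algebra_simps)
    qed
    then have "dist_Rn n ?x ?y = \<bar>a (Suc k) / A (Suc k)\<bar> * dist_Rn n ?z ?y"
      unfolding dist_Rn_def by (simp only: norm_Rn_scale)
    also have "\<dots> \<le> 2 / ?K * (4 * R0)"
    proof (rule mult_mono)
      show "\<bar>a (Suc k) / A (Suc k)\<bar> \<le> 2 / ?K"
        using a_over_A[of k] a_pos[of k] A_nonneg[of "Suc k"] by (simp add: less_imp_le)
      show "dist_Rn n ?z ?y \<le> 4 * R0"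
        using p dist_Rn_triangle[of n ?z ?y xs] dist_Rn_commute[of n xs ?y] by (simp add: near_def)
    qed auto
    finally have "dist_Rn n ?x ?y powr \<nu> \<le> (8 * R0 / ?K) powr \<nu>"
      using \<nu> by (intro powr_mono2) auto
    then have 1: "dist_Rn n (df ?x) (df ?y) \<le> M * (8 * R0 / ?K) powr \<nu>"
      using df_holder[OF xQ yQ] M by (smt (verit) mult_left_mono)
    have "A k * (f ?y - f xs) \<le> 2 * R0\<^sup>2"
      using energy zero_le_power2[of "dist_Rn n ?z xs"] unfolding energy_def by linarith
    then have "f ?y - f xs \<le> 2 * R0\<^sup>2 / A k" using Ak by (simp add: field_simps)
    then have 2: "norm_Rn n (df ?y) \<le> 2 * M powr (1 / (1 + \<nu>)) * (2 * R0\<^sup>2 / A k) powr (\<nu> / (1 + \<nu>))"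
      using Ak R0 by (intro norm_df_le_gap yQ) auto
    have "a (Suc k) * norm_Rn n (df ?x) \<le> a (Suc k) * (M * (8 * R0 / ?K) powr \<nu>)
        + a (Suc k) * (2 * M powr (1 / (1 + \<nu>)) * (2 * R0\<^sup>2 / A k) powr (\<nu> / (1 + \<nu>)))"
      unfolding distrib_left[symmetric]
      using 1 2 norm_Rn_le_dist[of n "df ?x" "df ?y"] a_pos[of k] by (intro mult_left_mono) auto
    also have "\<dots> \<le> B / 4 + B / 4"
      using False by (intro add_mono far_gradient_unclipped near_gradient_unclipped k) auto
    finally show ?thesis by simp
  qed
  then show ?thesis using a_pos[of k] by (simp add: field_simps)
qed

lemma advance_Rn:
  assumes "near p" "v \<in> Rn n"
  shows "fst (advance k v p) \<in> Rn n" "snd (advance k v p) \<in> Rn n"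
  using assms clip_Rn[OF assms(2)] by (auto simp: near_def advance_def Let_def Rn_iff)

text \<open>
Clipping limits the length of a step of \<open>z\<close> to \<open>B \<le> R\<^sub>0\<close>. This is why smoothness on the ball of radius
\<open>3 R\<^sub>0\<close> suffices although iterates are controlled only within \<open>2 R\<^sub>0\<close>: the inequality for
the new point is available before it is known whether the energy stays small.
\<close>
lemma advance_in_Q:
  assumes "near p" "v \<in> Rn n"
  shows "fst (advance k v p) \<in> Q"
proof -
  let ?z' = "snd (advance k v p)" and ?z = "snd p"
  have "dist_Rn n ?z' ?z = norm_Rn n (\<lambda>i. (- a (Suc k)) * clip n (B / a (Suc k)) v i)"
    by (simp add: dist_Rn_def advance_def Let_def)
  also have "\<dots> \<le> a (Suc k) * (B / a (Suc k))"
    using norm_clip_le[of "B / a (Suc k)" n v] a_pos[of k] B_pos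
    unfolding norm_Rn_scale by (intro mult_mono) auto
  also have "\<dots> \<le> R0" using a_pos[of k] B_le by simp
  finally have "dist_Rn n ?z' xs \<le> 3 * R0"
    using assms dist_Rn_triangle[of n ?z' xs ?z] by (simp add: near_def)
  moreover have "dist_Rn n (fst p) xs \<le> 3 * R0" using assms R0 by (simp add: near_def)
  ultimately have "dist_Rn n (fst (advance k v p)) xs \<le> 3 * R0"
    using A_nonneg[of k] a_pos[of k] A_Suc_pos[of k]
    by (auto simp: advance_def Let_def A_Suc intro!: dist_Rn_combination)
  then show ?thesis using advance_Rn[OF assms] by (intro in_QI)
qed

lemma advance_near:
  assumes p: "near p" and v: "v \<in> Rn n" and energy: "energy (Suc k) (advance k v p) \<le> 2 * R0\<^sup>2"
  shows "near (advance k v p)"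
proof -
  let ?q = "advance k v p"
  have "0 \<le> A (Suc k) * (f (fst ?q) - f xs)"
    using f_min[OF advance_Rn(1)[OF p v]] A_nonneg[of "Suc k"] by simp
  then have "(dist_Rn n (snd ?q) xs)\<^sup>2 \<le> (2 * R0)\<^sup>2"
    using energy unfolding energy_def by (simp add: power_mult_distrib)
  then have z: "dist_Rn n (snd ?q) xs \<le> 2 * R0"
    by (rule power2_le_imp_le) (use R0 in auto)
  then have "dist_Rn n (fst ?q) xs \<le> 2 * R0"
    using p A_nonneg[of k] a_pos[of k] A_Suc_pos[of k]
    by (auto simp: advance_def Let_def A_Suc near_def intro!: dist_Rn_combination)
  with z show ?thesis using advance_Rn[OF p v] by (simp add: near_def)
qed

lemma exp_energy_advance_le:
  assumes k: "k < N" and p: "near p" and energy: "energy k p \<le> 2 * R0\<^sup>2" and v: "v \<in> Rn n"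
  defines "\<mu> \<equiv> df (query k p)" and "w \<equiv> (\<lambda>i. snd p i - xs i)"
  shows "exp (energy (Suc k) (advance k v p) / (6 * B * R0))
    \<le> exp ((energy k p + err k) / (6 * B * R0))
      * (1 - a (Suc k) / (6 * B * R0) * inner_Rn n (\<lambda>i. v i - \<mu> i) w
         + (a (Suc k))\<^sup>2 / B\<^sup>2 * (dist_Rn n v \<mu>)\<^sup>2)"
proof -
  let ?G = "clip n (B / a (Suc k)) v"
  let ?W = "(a (Suc k))\<^sup>2 * (dist_Rn n ?G \<mu>)\<^sup>2 - a (Suc k) * inner_Rn n (\<lambda>i. ?G i - \<mu> i) w"
  have "energy (Suc k) (advance k v p) \<le> energy k p + err k + ?W"
    unfolding energy_def A_Suc err_def \<mu>_def w_def
  proof (rule sstm_step)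
    show "query k p \<in> Q" by (intro two_R0_Q query_near p)
    show "fst (advance k v p) \<in> Q" by (rule advance_in_Q[OF p v])
    show "0 < \<tau> (Suc k)" by (rule \<tau>_pos) simp
    show "M * ((a (Suc k))\<^sup>2 / (A k + a (Suc k))) * \<tau> (Suc k) powr (\<nu> - 1) \<le> 1 / 4"
      using stepsize_accel[of k] by (simp add: A_Suc)
  qed (use p A_nonneg[of k] a_pos[of k] in \<open>auto simp: near_def query_def advance_def Let_def A_Suc\<close>)
  then have "energy (Suc k) (advance k v p) / (6 * B * R0)
      \<le> (energy k p + err k + ?W) / (6 * B * R0)"
    using B_pos R0 by (intro divide_right_mono) auto
  then have "exp (energy (Suc k) (advance k v p) / (6 * B * R0))
      \<le> exp ((energy k p + err k) / (6 * B * R0)) * exp (?W / (6 * B * R0))"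
    by (simp add: exp_add[symmetric] add_divide_distrib)
  also have "\<dots> \<le> exp ((energy k p + err k) / (6 * B * R0))
      * (1 - a (Suc k) / (6 * B * R0) * inner_Rn n (\<lambda>i. v i - \<mu> i) w
         + (a (Suc k))\<^sup>2 / B\<^sup>2 * (dist_Rn n v \<mu>)\<^sup>2)"
  proof (intro mult_left_mono exp_clipped_noise_le)
    show "norm_Rn n \<mu> \<le> B / a (Suc k) / 2"
      unfolding \<mu>_def by (rule gradient_unclipped[OF k p energy])
    show "norm_Rn n w \<le> 2 * R0" using p by (simp add: near_def w_def dist_Rn_def)
  qed (use a_pos[of k] B_pos B_le in auto)
  finally show ?thesis .
qed

lemma prob_P: "prob_space P"
  and g_measurable: "(\<lambda>(x, \<xi>). g x \<xi>) \<in> borel_Rn n \<Otimes>\<^sub>M P \<rightarrow>\<^sub>M borel_Rn n"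
  using sampling by (auto simp: oracle_cond_def)

definition batch_space :: "nat \<Rightarrow> (nat \<times> nat \<Rightarrow> 'xi) measure" where
  "batch_space k = Pi\<^sub>M ({k} \<times> {..<m k}) (\<lambda>_. P)"

text \<open>
An upper bound on the probability that the energy, now equal to \<open>c\<close> after \<open>k\<close> iterations, will exceed
\<open>2 R\<^sub>0\<^sup>2\<close> later. The sum collects what each remaining iteration contributes to the exponent:
its deterministic error and the logarithm \<open>L / N\<close> of its exponential moment.
\<close>
definition failure_bound :: "nat \<Rightarrow> real \<Rightarrow> real" where
  "failure_bound k c
    = exp ((c - 2 * R0\<^sup>2) / (6 * B * R0) + (\<Sum>j\<in>{k..<N}. err j / (6 * B * R0) + L / real N))"

lemma err_nonneg: "0 \<le> err k"
  using A_nonneg[of "Suc k"] M by (simp add: err_def)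

lemma failure_bound_ge_1: "2 * R0\<^sup>2 \<le> c \<Longrightarrow> 1 \<le> failure_bound k c"
  unfolding failure_bound_def
  using B_pos R0 L err_nonneg by (auto intro!: add_nonneg_nonneg sum_nonneg)

text \<open>
The one-step supermartingale inequality, for the state \<open>p\<close> before the iteration held fixed. The
integrand is dominated pointwise by \<open>c * h\<close>, a polynomial in the
unclipped batch error, whose integral is known from \<open>batch_mean_moments\<close>.
\<close>
lemma expected_failure_bound_le:
  assumes k: "k < N" and p: "near p" and energy: "energy k p \<le> 2 * R0\<^sup>2"
  shows "(\<integral>\<^sup>+ \<omega>. ennreal (failure_bound (Suc k)
        (energy (Suc k) (advance k (batch_grad g m \<omega> k (query k p)) p))) \<partial>batch_space k)
    \<le> ennreal (failure_bound k (energy k p))"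
proof -
  interpret P: prob_space P by (rule prob_P)
  let ?x = "query k p" and ?S = "batch_space k"
  interpret S: prob_space ?S
    unfolding batch_space_def by (intro prob_space_PiM) (rule prob_P)
  define \<mu> where "\<mu> = df ?x"
  define w where "w = (\<lambda>i. snd p i - xs i)"
  define v where "v = (\<lambda>\<omega>. batch_grad g m \<omega> k ?x)"
  define rest where "rest = (\<Sum>j\<in>{Suc k..<N}. err j / (6 * B * R0) + L / real N)"
  define h where "h = (\<lambda>\<omega>. 1 - a (Suc k) / (6 * B * R0) * inner_Rn n (\<lambda>i. v \<omega> i - \<mu> i) w
         + (a (Suc k))\<^sup>2 / B\<^sup>2 * (dist_Rn n (v \<omega>) \<mu>)\<^sup>2)"
  define c where "c = exp ((energy k p + err k - 2 * R0\<^sup>2) / (6 * B * R0) + rest)"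
  have xQ: "?x \<in> Q" by (intro two_R0_Q query_near p)
  then have xR: "?x \<in> Rn n" by (rule Q_Rn)
  have sampling_x: "\<forall>i<n. integrable P (\<lambda>\<xi>. g ?x \<xi> i) \<and> (\<integral>\<xi>. g ?x \<xi> i \<partial>P) = \<mu> i"
    "integrable P (\<lambda>\<xi>. (dist_Rn n (g ?x \<xi>) \<mu>)\<^sup>2)" "(\<integral>\<xi>. (dist_Rn n (g ?x \<xi>) \<mu>)\<^sup>2 \<partial>P) \<le> \<sigma>\<^sup>2"
    using sampling xQ xR unfolding oracle_cond_def \<mu>_def by auto
  have mk: "0 < m k" using m_pos[OF k] by simp
  note moments = P.batch_mean_moments[OF mk, where n = n and X = "g ?x" and \<mu> = \<mu> and \<sigma> = \<sigma> and k = k,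
      folded batch_space_def]
  have v_eq: "v = (\<lambda>\<omega> i. (1 / real (m k)) * (\<Sum>j<m k. g ?x (\<omega> (k, j)) i))"
    by (simp add: v_def batch_grad_def)
  have int1: "integrable ?S (\<lambda>\<omega>. inner_Rn n (\<lambda>i. v \<omega> i - \<mu> i) w)"
    "(\<integral>\<omega>. inner_Rn n (\<lambda>i. v \<omega> i - \<mu> i) w \<partial>?S) = 0"
    "integrable ?S (\<lambda>\<omega>. (dist_Rn n (v \<omega>) \<mu>)\<^sup>2)"
    "(\<integral>\<omega>. (dist_Rn n (v \<omega>) \<mu>)\<^sup>2 \<partial>?S) \<le> \<sigma>\<^sup>2 / real (m k)"
    unfolding v_eq using moments sampling_x by auto
  have h_int: "integrable ?S h" unfolding h_def using int1 by auto
  have "(\<integral>\<omega>. h \<omega> \<partial>?S) = 1 + (a (Suc k))\<^sup>2 / B\<^sup>2 * (\<integral>\<omega>. (dist_Rn n (v \<omega>) \<mu>)\<^sup>2 \<partial>?S)"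
    unfolding h_def using int1 by (simp add: S.prob_space)
  also have "\<dots> \<le> 1 + (a (Suc k))\<^sup>2 / B\<^sup>2 * (\<sigma>\<^sup>2 / real (m k))"
    using int1 by (intro add_left_mono mult_left_mono) auto
  also have "\<dots> \<le> 1 + L / real N"
    using m_large[OF k] mk N L B_pos by (simp add: field_simps)
  also have "\<dots> \<le> exp (L / real N)" by (rule exp_ge_add_one_self)
  finally have h_le: "(\<integral>\<omega>. h \<omega> \<partial>?S) \<le> exp (L / real N)" .
  have pointwise: "failure_bound (Suc k) (energy (Suc k) (advance k (v \<omega>) p)) \<le> c * h \<omega>"
    if \<omega>: "\<omega> \<in> space ?S" for \<omega>
  proof -
    have "v \<omega> \<in> Rn n"
      unfolding v_def
    proof (rule batch_grad_Rn)
      fix j assume "j < m k"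
      then have "\<omega> (k, j) \<in> space P" using \<omega> by (auto simp: batch_space_def space_PiM)
      then show "g ?x (\<omega> (k, j)) \<in> Rn n"
        using measurable_space[OF g_measurable, of "(?x, \<omega> (k, j))"] xR
        by (auto simp: space_pair_measure space_restrict_space)
    qed
    from exp_energy_advance_le[OF k p energy this]
    have "exp (energy (Suc k) (advance k (v \<omega>) p) / (6 * B * R0))
        \<le> exp ((energy k p + err k) / (6 * B * R0)) * h \<omega>"
      by (simp add: h_def \<mu>_def w_def)
    then have "exp (energy (Suc k) (advance k (v \<omega>) p) / (6 * B * R0)) * exp (rest - 2 * R0\<^sup>2 / (6 * B * R0))
        \<le> exp ((energy k p + err k) / (6 * B * R0)) * h \<omega> * exp (rest - 2 * R0\<^sup>2 / (6 * B * R0))"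
      by (intro mult_right_mono) auto
    also have "\<dots> = c * h \<omega>"
      by (simp add: c_def exp_add exp_diff diff_divide_distrib)
    also have "exp (energy (Suc k) (advance k (v \<omega>) p) / (6 * B * R0)) * exp (rest - 2 * R0\<^sup>2 / (6 * B * R0))
        = failure_bound (Suc k) (energy (Suc k) (advance k (v \<omega>) p))"
      by (simp add: failure_bound_def rest_def[symmetric] exp_add exp_diff diff_divide_distrib)
    finally show ?thesis .
  qed
  have "(\<integral>\<^sup>+ \<omega>. ennreal (failure_bound (Suc k) (energy (Suc k) (advance k (v \<omega>) p))) \<partial>?S)
      \<le> (\<integral>\<^sup>+ \<omega>. ennreal (c * h \<omega>) \<partial>?S)"
    by (intro nn_integral_mono ennreal_leI pointwise)
  also have "\<dots> = ennreal (\<integral>\<omega>. c * h \<omega> \<partial>?S)"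
  proof (rule nn_integral_eq_integral)
    show "integrable ?S (\<lambda>\<omega>. c * h \<omega>)" using h_int by simp
    show "AE \<omega> in ?S. 0 \<le> c * h \<omega>"
    proof (rule AE_I2)
      fix \<omega> assume "\<omega> \<in> space ?S"
      from pointwise[OF this] show "0 \<le> c * h \<omega>"
        by (rule order_trans[rotated]) (simp add: failure_bound_def)
    qed
  qed
  also have "(\<integral>\<omega>. c * h \<omega> \<partial>?S) \<le> c * exp (L / real N)"
    using h_le by (simp add: c_def)
  also have "c * exp (L / real N) = failure_bound k (energy k p)"
  proof -
    have "{k..<N} = insert k {Suc k..<N}" using k by auto
    then have "(\<Sum>j\<in>{k..<N}. err j / (6 * B * R0) + L / real N) = err k / (6 * B * R0) + L / real N + rest"
      by (simp add: rest_def)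
    then show ?thesis
      by (simp add: c_def failure_bound_def exp_add[symmetric] add_divide_distrib diff_divide_distrib)
  qed
  finally show ?thesis by (simp add: v_def ennreal_leI)
qed

definition in_control :: "nat \<Rightarrow> (nat \<times> nat \<Rightarrow> 'xi) \<Rightarrow> bool" where
  "in_control k \<omega> \<longleftrightarrow> (\<forall>j\<le>k. energy j (yz j \<omega>) \<le> 2 * R0\<^sup>2)"

text \<open>
The process is sent to 1, not stopped at its current value, once the energy has been too large. Since
\<open>failure_bound\<close> is at least 1 there, this only decreases it.
\<close>
definition killed :: "nat \<Rightarrow> (nat \<times> nat \<Rightarrow> 'xi) \<Rightarrow> real" where
  "killed k \<omega> = (if in_control k \<omega> then failure_bound k (energy k (yz k \<omega>)) else 1)"

lemma in_control_near:
  assumes "in_control k \<omega>" "k \<le> K" "\<omega> \<in> space (sample_space K m P)"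
  shows "near (yz k \<omega>)"
  using assms(1,2)
proof (induction k)
  case 0
  then show ?case using x0 R0 by (auto simp: near_def)
next
  case (Suc k)
  let ?x = "query k (yz k \<omega>)"
  have near: "near (yz k \<omega>)" using Suc by (auto simp: in_control_def)
  have "batch_grad g m \<omega> k ?x \<in> Rn n"
  proof (rule batch_grad_Rn)
    fix j assume "j < m k"
    then have "\<omega> (k, j) \<in> space P" using space_sample_spaceD[OF assms(3)] Suc.prems by auto
    then show "g ?x (\<omega> (k, j)) \<in> Rn n"
      using measurable_space[OF g_measurable, of "(?x, \<omega> (k, j))"] query_near[OF near]
      by (auto simp: space_pair_measure space_restrict_space)
  qed
  then show ?case
    unfolding yz_Suc using near Suc.prems(1) yz_Suc
    by (intro advance_near) (auto simp: in_control_def)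
qed

lemma energy_measurable:
  assumes "j \<le> K"
  shows "(\<lambda>\<omega>. energy j (yz j \<omega>)) \<in> borel_measurable (sample_space K m P)"
proof -
  note yz_meas = sstm_yz_measurable[OF g_measurable x0(1) assms, of \<nu> m \<alpha> B]
  have "(\<lambda>\<omega>. f (fst (yz j \<omega>))) \<in> borel_measurable (sample_space K m P)"
    by (rule measurable_compose[OF conjunct1[OF yz_meas] f_measurable])
  moreover have "(\<lambda>\<omega>. dist_Rn n (snd (yz j \<omega>)) xs) \<in> borel_measurable (sample_space K m P)"
    by (rule dist_Rn_measurable[OF conjunct2[OF yz_meas]])
  ultimately show ?thesis unfolding energy_def
    by (intro borel_measurable_add borel_measurable_times borel_measurable_diff
        borel_measurable_divide borel_measurable_power borel_measurable_const)
qed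

lemma in_control_sets:
  assumes "k \<le> K"
  shows "{\<omega> \<in> space (sample_space K m P). in_control k \<omega>} \<in> sets (sample_space K m P)"
proof -
  have "{\<omega> \<in> space (sample_space K m P). energy j (yz j \<omega>) \<le> 2 * R0\<^sup>2} \<in> sets (sample_space K m P)"
    if "j \<in> {..k}" for j
    using that assms by (intro borel_measurable_le energy_measurable borel_measurable_const) simp
  then have "{\<omega> \<in> space (sample_space K m P). \<forall>j\<in>{..k}. energy j (yz j \<omega>) \<le> 2 * R0\<^sup>2}
      \<in> sets (sample_space K m P)"
    by (rule sets.sets_Collect_finite_All) auto
  then show ?thesis by (simp only: in_control_def atMost_iff Ball_def)
qed

lemma killed_measurable:
  assumes "k \<le> K"
  shows "(\<lambda>\<omega>. ennreal (killed k \<omega>)) \<in> borel_measurable (sample_space K m P)"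
proof -
  have E: "(\<lambda>\<omega>. failure_bound k (energy k (yz k \<omega>))) \<in> borel_measurable (sample_space K m P)"
    unfolding failure_bound_def
    by (intro borel_measurable_exp borel_measurable_add borel_measurable_divide borel_measurable_diff
        borel_measurable_const measurable_compose[OF _ borel_measurable_exp] energy_measurable assms)
  show ?thesis
    unfolding killed_def
    by (intro measurable_compose[OF _ measurable_ennreal] measurable_If E borel_measurable_const
        in_control_sets assms)
qed

text \<open>
The samples of iteration \<open>k\<close> are independent of the state before it because the product measure splits
into the coordinates of earlier iterations and those of iteration \<open>k\<close>. Fubini's theorem thus plays
the role of conditional expectation.
\<close>
lemma killed_supermartingale:
  assumes "k \<le> N"
  shows "(\<integral>\<^sup>+ \<omega>. ennreal (killed k \<omega>) \<partial>sample_space k m P)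
    \<le> ennreal (failure_bound 0 (energy 0 (x0, x0)))"
  using assms
proof (induction k)
  case 0
  have "killed 0 \<omega> \<le> failure_bound 0 (energy 0 (x0, x0))" for \<omega>
    using failure_bound_ge_1[of "energy 0 (x0, x0)" 0] by (auto simp: killed_def in_control_def)
  then have "(\<integral>\<^sup>+ \<omega>. ennreal (killed 0 \<omega>) \<partial>sample_space 0 m P)
      \<le> (\<integral>\<^sup>+ \<omega>. ennreal (failure_bound 0 (energy 0 (x0, x0))) \<partial>sample_space 0 m P)"
    by (intro nn_integral_mono ennreal_leI)
  also have "\<dots> = ennreal (failure_bound 0 (energy 0 (x0, x0)))"
    by (simp add: sample_space_def PiM_empty)
  finally show ?case .
next
  case (Suc k)
  interpret P: prob_space P by (rule prob_P)
  interpret PP: product_sigma_finite "\<lambda>_::nat \<times> nat. P" by unfold_locales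
  let ?I = "SIGMA j:{..<k}. {..<m j}" and ?J = "{k} \<times> {..<m k}"
  interpret S: prob_space "batch_space k"
    unfolding batch_space_def by (intro prob_space_PiM) (rule prob_P)
  have IJ: "(SIGMA j:{..<Suc k}. {..<m j}) = ?I \<union> ?J" by (auto simp: less_Suc_eq)
  have "(\<integral>\<^sup>+ \<omega>. ennreal (killed (Suc k) \<omega>) \<partial>sample_space (Suc k) m P)
      = (\<integral>\<^sup>+ \<omega>1. (\<integral>\<^sup>+ \<omega>2. ennreal (killed (Suc k) (merge ?I ?J (\<omega>1, \<omega>2))) \<partial>batch_space k)
          \<partial>sample_space k m P)"
    unfolding sample_space_def IJ batch_space_def
  proof (rule PP.product_nn_integral_fold)
    show "(\<lambda>\<omega>. ennreal (killed (Suc k) \<omega>)) \<in> borel_measurable (Pi\<^sub>M (?I \<union> ?J) (\<lambda>_. P))"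
      using killed_measurable[of "Suc k" "Suc k"] unfolding sample_space_def IJ by simp
  qed auto
  also have "\<dots> \<le> (\<integral>\<^sup>+ \<omega>1. ennreal (killed k \<omega>1) \<partial>sample_space k m P)"
  proof (rule nn_integral_mono)
    fix \<omega>1 assume \<omega>1: "\<omega>1 \<in> space (sample_space k m P)"
    let ?mg = "\<lambda>\<omega>2. merge ?I ?J (\<omega>1, \<omega>2)"
    have past: "yz j (?mg \<omega>2) = yz j \<omega>1" if "j \<le> k" for j \<omega>2
      using that by (intro sstm_yz_cong) (auto simp: merge_def)
    have present: "batch_grad g m (?mg \<omega>2) k x = batch_grad g m \<omega>2 k x" for \<omega>2 x
      by (auto simp: batch_grad_def merge_def intro!: sum.cong)
    have next_yz: "yz (Suc k) (?mg \<omega>2)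
        = advance k (batch_grad g m \<omega>2 k (query k (yz k \<omega>1))) (yz k \<omega>1)" for \<omega>2
      unfolding yz_Suc past[OF order_refl] present ..
    have ctrl: "in_control (Suc k) (?mg \<omega>2)
        \<longleftrightarrow> in_control k \<omega>1 \<and> energy (Suc k) (yz (Suc k) (?mg \<omega>2)) \<le> 2 * R0\<^sup>2" for \<omega>2
      unfolding in_control_def using past by (auto simp: le_Suc_eq simp del: sstm_yz.simps)
    show "(\<integral>\<^sup>+ \<omega>2. ennreal (killed (Suc k) (?mg \<omega>2)) \<partial>batch_space k) \<le> ennreal (killed k \<omega>1)"
    proof (cases "in_control k \<omega>1")
      case False
      then show ?thesis by (simp add: killed_def ctrl S.emeasure_space_1)
    next
      case True
      have "killed (Suc k) (?mg \<omega>2) \<le> failure_bound (Suc k) (energy (Suc k) (yz (Suc k) (?mg \<omega>2)))" for \<omega>2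
        using True failure_bound_ge_1[of "energy (Suc k) (yz (Suc k) (?mg \<omega>2))" "Suc k"]
        unfolding killed_def ctrl by auto
      then have "(\<integral>\<^sup>+ \<omega>2. ennreal (killed (Suc k) (?mg \<omega>2)) \<partial>batch_space k)
          \<le> (\<integral>\<^sup>+ \<omega>2. ennreal (failure_bound (Suc k) (energy (Suc k) (yz (Suc k) (?mg \<omega>2)))) \<partial>batch_space k)"
        by (intro nn_integral_mono ennreal_leI)
      also have "\<dots> \<le> ennreal (failure_bound k (energy k (yz k \<omega>1)))"
        unfolding next_yz
        using Suc.prems True in_control_near[OF True order_refl \<omega>1]
        by (intro expected_failure_bound_le) (auto simp: in_control_def)
      also have "\<dots> = ennreal (killed k \<omega>1)" using True by (simp add: killed_def)
      finally show ?thesis .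
    qed
  qed
  also have "\<dots> \<le> ennreal (failure_bound 0 (energy 0 (x0, x0)))" using Suc by simp
  finally show ?case .
qed

text \<open>
Initially the energy is at most \<open>R\<^sub>0\<^sup>2 / 2\<close> and the deterministic errors add at most \<open>R\<^sub>0\<^sup>2 / 2\<close>, which
leaves a margin of \<open>R\<^sub>0\<^sup>2\<close>. In units of \<open>6 B R\<^sub>0\<close> this margin is \<open>2 L\<close>, twice what the
exponential moments of all iterations consume.
\<close>
lemma initial_failure_bound: "failure_bound 0 (energy 0 (x0, x0)) \<le> exp (- L)"
proof -
  have "(dist_Rn n x0 xs)\<^sup>2 \<le> R0\<^sup>2" using x0 by (intro power_mono) auto
  then have "energy 0 (x0, x0) \<le> R0\<^sup>2 / 2" by (simp add: energy_def)
  then have "energy 0 (x0, x0) - 2 * R0\<^sup>2 + (\<Sum>j<N. err j) \<le> - R0\<^sup>2"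
    using sum_err by simp
  then have "(energy 0 (x0, x0) - 2 * R0\<^sup>2 + (\<Sum>j<N. err j)) / (6 * B * R0) \<le> - R0\<^sup>2 / (6 * B * R0)"
    using B_pos R0 by (intro divide_right_mono) auto
  also have "\<dots> = - 2 * L" using R0 L by (simp add: B_eq power2_eq_square)
  finally have "(energy 0 (x0, x0) - 2 * R0\<^sup>2) / (6 * B * R0) + (\<Sum>j<N. err j) / (6 * B * R0) + L \<le> - L"
    by (simp add: add_divide_distrib)
  then show ?thesis
    using N by (simp add: failure_bound_def sum.distrib sum_divide_distrib atLeast0LessThan)
qed

theorem high_probability_accuracy:
  "1 - exp (- L) \<le> \<P>(\<omega> in sample_space N m P. f (sstm_output n \<nu> N m \<alpha> B g x0 \<omega>) - f xs \<le> \<epsilon>)"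
proof -
  let ?S = "sample_space N m P"
  let ?good = "{\<omega> \<in> space ?S. f (sstm_output n \<nu> N m \<alpha> B g x0 \<omega>) - f xs \<le> \<epsilon>}"
  interpret S: prob_space ?S
    unfolding sample_space_def by (intro prob_space_PiM) (rule prob_P)
  have good_sets: "?good \<in> sets ?S"
  proof -
    have "(\<lambda>\<omega>. f (fst (yz N \<omega>))) \<in> borel_measurable ?S"
      using sstm_yz_measurable[OF g_measurable x0(1) order_refl, of \<nu> m \<alpha> B]
      by (intro measurable_compose[OF _ f_measurable]) simp
    then show ?thesis
      unfolding sstm_output_def
      by (intro borel_measurable_le borel_measurable_diff borel_measurable_const)
  qed
  have good: "\<omega> \<in> ?good" if "in_control N \<omega>" "\<omega> \<in> space ?S" for \<omega>
  proof -
    have "energy N (yz N \<omega>) \<le> 2 * R0\<^sup>2" using that by (simp add: in_control_def)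
    then have "A N * (f (fst (yz N \<omega>)) - f xs) \<le> 2 * R0\<^sup>2"
      using zero_le_power2[of "dist_Rn n (snd (yz N \<omega>)) xs"] unfolding energy_def by linarith
    also have "\<dots> \<le> A N * \<epsilon>" using A_N by (simp add: mult.commute)
    finally have "f (fst (yz N \<omega>)) - f xs \<le> \<epsilon>"
    proof (rule mult_left_le_imp_le)
      have "0 < \<epsilon> * A N" using A_N R0 by (intro less_le_trans[OF _ A_N]) simp
      then show "0 < A N" using \<epsilon> by (simp add: zero_less_mult_iff)
    qed
    then show ?thesis using that by (simp add: sstm_output_def)
  qed
  have "emeasure ?S (space ?S - ?good) = (\<integral>\<^sup>+ \<omega>. indicator (space ?S - ?good) \<omega> \<partial>?S)"
    using good_sets by simp
  also have "\<dots> \<le> (\<integral>\<^sup>+ \<omega>. ennreal (killed N \<omega>) \<partial>?S)"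
  proof (rule nn_integral_mono)
    fix \<omega> assume "\<omega> \<in> space ?S"
    then show "indicator (space ?S - ?good) \<omega> \<le> ennreal (killed N \<omega>)"
      using good[of \<omega>] by (cases "in_control N \<omega>") (auto simp: killed_def indicator_def)
  qed
  also have "\<dots> \<le> ennreal (exp (- L))"
    using killed_supermartingale[of N] initial_failure_bound
    by (meson order_trans ennreal_leI order_refl)
  finally have "S.prob (space ?S - ?good) \<le> exp (- L)"
    by (simp add: S.emeasure_eq_measure)
  then show ?thesis using S.prob_compl[OF good_sets] by simp
qed

end

section \<open>Iteration and sample complexity\<close>

lemma sum_powr_le:
  fixes s :: real
  assumes "0 \<le> s"
  shows "(\<Sum>k<N. (real (Suc k) powr s)\<^sup>2) \<le> real N * (real N powr s)\<^sup>2"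
proof -
  have "(\<Sum>k<N. (real (Suc k) powr s)\<^sup>2) \<le> (\<Sum>k<N. (real N powr s)\<^sup>2)"
    using assms by (intro sum_mono power_mono powr_mono2) auto
  then show ?thesis by simp
qed

context sstm_schedule
begin

text \<open>
The variance of \<open>a\<^sub>k\<^sub>+\<^sub>1\<close> times the mini-batch gradient is to be at most \<open>B\<^sup>2 L / N\<close>. Allowing the factor \<open>L\<close>
here saves one logarithm in the number of samples, because the total exponent may be of order \<open>L\<close>.
\<close>
definition batch_size :: "real \<Rightarrow> nat \<Rightarrow> nat" where
  "batch_size \<sigma> k = max 1 (nat \<lceil>(a (Suc k))\<^sup>2 * \<sigma>\<^sup>2 * real N / (B\<^sup>2 * L)\<rceil>)"

lemma batch_size_ge:
  "1 \<le> batch_size \<sigma> k" "(a (Suc k))\<^sup>2 * \<sigma>\<^sup>2 * real N / (B\<^sup>2 * L) \<le> real (batch_size \<sigma> k)"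
  unfolding batch_size_def by (simp, linarith)

text \<open>
The constant is \<open>16 * 144\<close>: the squared weights sum to at most \<open>N (\<alpha> N\<^sup>s)\<^sup>2 = 16 R\<^sub>0\<^sup>4 / (\<epsilon>\<^sup>2 N)\<close>, and
\<open>1 / B\<^sup>2 = 144 L\<^sup>2 / R\<^sub>0\<^sup>2\<close>.
\<close>
lemma total_batch_size:
  "real (oracle_calls N (batch_size \<sigma>)) \<le> real N + 2304 * (\<sigma>\<^sup>2 * R0\<^sup>2 / \<epsilon>\<^sup>2 * L)"
proof -
  define c where "c = \<sigma>\<^sup>2 * real N / (B\<^sup>2 * L)"
  have c: "0 \<le> c" using L by (simp add: c_def)
  have "real (batch_size \<sigma> k) \<le> 1 + c * (a (Suc k))\<^sup>2" for k
  proof -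
    have "0 \<le> c * (a (Suc k))\<^sup>2" using c by simp
    moreover have "(a (Suc k))\<^sup>2 * \<sigma>\<^sup>2 * real N / (B\<^sup>2 * L) = c * (a (Suc k))\<^sup>2"
      by (simp add: c_def)
    ultimately show ?thesis unfolding batch_size_def by simp linarith
  qed
  then have "real (oracle_calls N (batch_size \<sigma>)) \<le> (\<Sum>k<N. 1 + c * (a (Suc k))\<^sup>2)"
    unfolding oracle_calls_def of_nat_sum by (intro sum_mono)
  also have "\<dots> = real N + c * \<alpha>\<^sup>2 * (\<Sum>k<N. (real (Suc k) powr s)\<^sup>2)"
    by (simp add: sum.distrib sum_distrib_left a_Suc power_mult_distrib algebra_simps)
  also have "\<dots> \<le> real N + c * \<alpha>\<^sup>2 * (real N * (real N powr s)\<^sup>2)"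
    using c s_bounds by (intro add_left_mono mult_left_mono sum_powr_le) auto
  also have "c * \<alpha>\<^sup>2 * (real N * (real N powr s)\<^sup>2) = 2304 * (\<sigma>\<^sup>2 * R0\<^sup>2 / \<epsilon>\<^sup>2 * L)"
  proof -
    have "real N * (real N powr s) * \<alpha> = 4 * R0\<^sup>2 / \<epsilon>"
      using N \<epsilon> by (simp add: \<alpha>_eq_s powr_add)
    moreover have "c * \<alpha>\<^sup>2 * (real N * (real N powr s)\<^sup>2)
        = \<sigma>\<^sup>2 / (B\<^sup>2 * L) * (real N * (real N powr s) * \<alpha>)\<^sup>2"
      by (simp add: c_def power2_eq_square)
    ultimately have "c * \<alpha>\<^sup>2 * (real N * (real N powr s)\<^sup>2) = \<sigma>\<^sup>2 / (B\<^sup>2 * L) * (4 * R0\<^sup>2 / \<epsilon>)\<^sup>2"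
      by simp
    then show ?thesis using R0 L \<epsilon> by (simp add: B_eq power2_eq_square field_simps)
  qed
  finally show ?thesis .
qed

end

lemma rate_D_eq:
  assumes "0 \<le> \<nu>" "0 < M" "0 < R0" "0 < \<epsilon>"
  shows "rate_D \<nu> M R0 \<epsilon> = (M * R0 powr (1 + \<nu>) / \<epsilon>) powr (2 / (1 + 3 * \<nu>))"
  using assms by (simp add: rate_D_def powr_mult powr_divide powr_powr algebra_simps)

lemma (in holder_problem) initial_point_accurate:
  assumes "x0 \<in> Rn n" "dist_Rn n x0 xs \<le> R0" "M * R0 powr (1 + \<nu>) / \<epsilon> \<le> 1" "0 < \<epsilon>"
  shows "f x0 - f xs \<le> \<epsilon>"
proof -
  have "f x0 - f xs \<le> M * dist_Rn n x0 xs powr \<nu> * dist_Rn n x0 xs"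
    using assms R0 by (intro gap_le_dist in_QI) auto
  also have "\<dots> \<le> M * R0 powr \<nu> * R0"
    using assms M R0 \<nu> by (intro mult_mono powr_mono2 mult_left_mono) auto
  also have "\<dots> = M * R0 powr (1 + \<nu>)" using R0 by (simp add: powr_add)
  also have "\<dots> \<le> \<epsilon>" using assms by (simp add: field_simps)
  finally show ?thesis .
qed

text \<open>
For \<open>D > 1\<close>, equivalently \<open>X = M R\<^sub>0\<^bsup>1+\<nu>\<^esup> / \<epsilon> > 1\<close>, the requirement \<open>L X\<^bsup>1/(1+\<nu>)\<^esup>\<close> of clipping is below
\<open>D L\<^bsup>2(1+\<nu>)/(1+3\<nu>)\<^esup>\<close>, since \<open>1 / (1 + \<nu>) \<le> 2 / (1 + 3 \<nu>)\<close> and the exponent of \<open>L\<close> is at least 1 for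
\<open>\<nu> \<le> 1\<close>. The bound 1537 leaves room for rounding \<open>1536 D L\<^bsup>2(1+\<nu>)/(1+3\<nu>)\<^esup> \<ge> 1\<close> up to an integer.
\<close>
lemma schedule_exists:
  fixes \<nu> M R0 \<epsilon> \<beta> :: real
  assumes \<nu>: "0 \<le> \<nu>" "\<nu> \<le> 1" and pos: "0 < M" "0 < R0" "0 < \<epsilon>" "0 < \<beta>" "\<beta> < 1"
  defines "D \<equiv> rate_D \<nu> M R0 \<epsilon>"
  assumes D: "1 < D"
  obtains N \<alpha> B where "sstm_schedule \<nu> M R0 \<epsilon> (log_factor D \<beta>) N \<alpha> B"
    and "real N \<le> 1537 * iteration_bound \<nu> D \<beta>"
proof -
  define X where "X = M * R0 powr (1 + \<nu>) / \<epsilon>"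
  define L where "L = log_factor D \<beta>"
  define I where "I = iteration_bound \<nu> D \<beta>"
  define N where "N = nat \<lceil>1536 * I\<rceil>"
  have L: "1 \<le> L" by (simp add: L_def log_factor_def)
  have X0: "0 < X" using pos by (simp add: X_def)
  have D_X: "D = X powr (2 / (1 + 3 * \<nu>))" using \<nu> pos by (simp add: D_def rate_D_eq X_def)
  have X: "1 \<le> X"
  proof (rule ccontr)
    assume "\<not> 1 \<le> X"
    then have "D \<le> 1" unfolding D_X using X0 \<nu> by (intro powr_le1) auto
    then show False using D by simp
  qed
  have e1: "1 / (1 + \<nu>) \<le> 2 / (1 + 3 * \<nu>)" "1 \<le> 2 * (1 + \<nu>) / (1 + 3 * \<nu>)"
    using \<nu> by (auto simp: field_simps)
  have L_p: "L \<le> L powr (2 * (1 + \<nu>) / (1 + 3 * \<nu>))"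
    using powr_mono[OF e1(2) L] L by simp
  have I_eq: "I = D * L powr (2 * (1 + \<nu>) / (1 + 3 * \<nu>))"
    by (simp add: I_def iteration_bound_def L_def)
  have "X powr (1 / (1 + \<nu>)) \<le> D" unfolding D_X using e1 X by (intro powr_mono) auto
  then have LX: "L * X powr (1 / (1 + \<nu>)) \<le> I"
    unfolding I_eq using mult_mono[OF L_p, of "X powr (1 / (1 + \<nu>))" D] D by (simp add: mult.commute)
  have DI: "D \<le> I" using mult_left_mono[of 1 "L powr (2 * (1 + \<nu>) / (1 + 3 * \<nu>))" D] L L_p D
    by (simp add: I_eq)
  have N_ge: "1536 * I \<le> real N" unfolding N_def by (rule real_nat_ceiling_ge)
  have N_le: "real N \<le> 1537 * I" using DI D unfolding N_def by linarith
  define \<alpha> where "\<alpha> = 4 * R0\<^sup>2 / (\<epsilon> * real N powr ((1 + 3 * \<nu>) / (1 + \<nu>)))"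
  have "sstm_schedule \<nu> M R0 \<epsilon> L N \<alpha> (R0 / (12 * L))"
  proof
    show "1 \<le> N" using N_ge DI D by linarith
    show "1536 * L * (M * R0 powr (1 + \<nu>) / \<epsilon>) powr (1 / (1 + \<nu>)) \<le> real N"
      using LX N_ge by (simp add: X_def[symmetric])
    have q: "1 \<le> (1 + 3 * \<nu>) / (1 + \<nu>)" using \<nu> by (simp add: field_simps)
    have "256 * X powr (2 / (1 + \<nu>)) = 256 * D powr ((1 + 3 * \<nu>) / (1 + \<nu>))"
    proof -
      have "2 / p * (p / q) = 2 / q" if "p \<noteq> 0" for p q :: real using that by simp
      from this[of "1 + 3 * \<nu>" "1 + \<nu>"]
      have "2 / (1 + 3 * \<nu>) * ((1 + 3 * \<nu>) / (1 + \<nu>)) = 2 / (1 + \<nu>)" using \<nu> by linarith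
      then show ?thesis unfolding D_X powr_powr by simp
    qed
    also have "\<dots> \<le> 256 powr ((1 + 3 * \<nu>) / (1 + \<nu>)) * D powr ((1 + 3 * \<nu>) / (1 + \<nu>))"
      using powr_mono[OF q, of 256] by (intro mult_right_mono) auto
    also have "\<dots> = (256 * D) powr ((1 + 3 * \<nu>) / (1 + \<nu>))" using D by (simp add: powr_mult)
    also have "\<dots> \<le> real N powr ((1 + 3 * \<nu>) / (1 + \<nu>))"
      using N_ge DI D q by (intro powr_mono2) auto
    finally show "256 * (M * R0 powr (1 + \<nu>) / \<epsilon>) powr (2 / (1 + \<nu>))
      \<le> real N powr ((1 + 3 * \<nu>) / (1 + \<nu>))"
      by (simp add: X_def[symmetric])
  qed (use \<nu> pos L in \<open>auto simp: \<alpha>_def\<close>)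
  then show thesis using N_le that by (simp add: L_def I_def)
qed

lemma exp_minus_log_factor_le:
  assumes "1 \<le> D" "0 < \<beta>"
  shows "exp (- log_factor D \<beta>) \<le> \<beta>"
proof -
  have "ln (1 / \<beta>) \<le> ln (D / \<beta>)" using assms by (simp add: divide_right_mono)
  also have "\<dots> \<le> log_factor D \<beta>" by (simp add: log_factor_def)
  finally have "- log_factor D \<beta> \<le> ln \<beta>" using assms by (simp add: ln_div)
  then have "exp (- log_factor D \<beta>) \<le> exp (ln \<beta>)" by (subst exp_le_cancel_iff)
  then show ?thesis using assms by simp
qed

theorem theorem2p1:
  fixes \<nu> :: real
  assumes "0 \<le> \<nu>" and "\<nu> \<le> 1"
  shows "\<exists>C>0. \<forall>M R0 \<sigma> \<epsilon> \<beta> :: real.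
    M > 0 \<and> R0 > 0 \<and> \<sigma> > 0 \<and> \<epsilon> > 0 \<and> 0 < \<beta> \<and> \<beta> < 1 \<longrightarrow>
    (let D = rate_D \<nu> M R0 \<epsilon> in
     \<exists>(N :: nat) (m :: nat \<Rightarrow> nat) (\<alpha> :: real) (B :: real).
       (\<forall>k<N. 1 \<le> m k) \<and> \<alpha> > 0 \<and> B > 0 \<and>
       real N \<le> C * iteration_bound \<nu> D \<beta> \<and>
       real (oracle_calls N m)
         \<le> C * max (iteration_bound \<nu> D \<beta>) (\<sigma>\<^sup>2 * R0\<^sup>2 / \<epsilon>\<^sup>2 * log_factor D \<beta>) \<and>
       (\<forall>(n :: nat) (f :: vec \<Rightarrow> real) (df :: vec \<Rightarrow> vec) (xs :: vec) (x0 :: vec)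
          (P :: 'xi measure) (g :: vec \<Rightarrow> 'xi \<Rightarrow> vec).
          convex_Rn n f \<and> is_minimizer n f xs \<and> x0 \<in> Rn n \<and> dist_Rn n x0 xs \<le> R0 \<and>
          gradient_field n \<nu> f xs (cball_Rn n xs (3 * R0)) df \<and>
          smoothness_cond n \<nu> M f xs (cball_Rn n xs (3 * R0)) df \<and>
          oracle_cond n \<sigma> (cball_Rn n xs (3 * R0)) df P g \<longrightarrow>
          \<P>(\<omega> in sample_space N m P. f (sstm_output n \<nu> N m \<alpha> B g x0 \<omega>) - f xs \<le> \<epsilon>) \<ge> 1 - \<beta>))"
proof -
  have "\<exists>(N :: nat) (m :: nat \<Rightarrow> nat) (\<alpha> :: real) (B :: real).
       (\<forall>k<N. 1 \<le> m k) \<and> \<alpha> > 0 \<and> B > 0 \<and>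
       real N \<le> 4000 * iteration_bound \<nu> D \<beta> \<and>
       real (oracle_calls N m)
         \<le> 4000 * max (iteration_bound \<nu> D \<beta>) (\<sigma>\<^sup>2 * R0\<^sup>2 / \<epsilon>\<^sup>2 * log_factor D \<beta>) \<and>
       (\<forall>(n :: nat) (f :: vec \<Rightarrow> real) (df :: vec \<Rightarrow> vec) (xs :: vec) (x0 :: vec)
          (P :: 'xi measure) (g :: vec \<Rightarrow> 'xi \<Rightarrow> vec).
          convex_Rn n f \<and> is_minimizer n f xs \<and> x0 \<in> Rn n \<and> dist_Rn n x0 xs \<le> R0 \<and>
          gradient_field n \<nu> f xs (cball_Rn n xs (3 * R0)) df \<and>
          smoothness_cond n \<nu> M f xs (cball_Rn n xs (3 * R0)) df \<and>
          oracle_cond n \<sigma> (cball_Rn n xs (3 * R0)) df P g \<longrightarrow>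
          \<P>(\<omega> in sample_space N m P. f (sstm_output n \<nu> N m \<alpha> B g x0 \<omega>) - f xs \<le> \<epsilon>) \<ge> 1 - \<beta>)"
    (is "\<exists>N m \<alpha> B. ?works N m \<alpha> B")
    if pos: "0 < M" "0 < R0" "0 < \<sigma>" "0 < \<epsilon>" "0 < \<beta>" "\<beta> < 1"
      and D_def: "D = rate_D \<nu> M R0 \<epsilon>"
    for M R0 \<sigma> \<epsilon> \<beta> D :: real
  proof -
    define X where "X = M * R0 powr (1 + \<nu>) / \<epsilon>"
    have X0: "0 < X" using pos by (simp add: X_def)
    have D_X: "D = X powr (2 / (1 + 3 * \<nu>))" using assms pos by (simp add: D_def rate_D_eq X_def)
    have D0: "0 < D" using X0 by (simp add: D_X)
    have I0: "0 \<le> iteration_bound \<nu> D \<beta>" using D0 by (simp add: iteration_bound_def)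
    show ?thesis
    proof (cases "D \<le> 1")
      \<comment> \<open>the only admissible number of iterations may be 0, and the starting point is accurate\<close>
      case True
      have X: "X \<le> 1"
      proof (rule ccontr)
        assume "\<not> X \<le> 1"
        then have "1 < X powr (2 / (1 + 3 * \<nu>))" using assms by (intro gr_one_powr) auto
        then show False using True by (simp add: D_X)
      qed
      have "?works 0 (\<lambda>_. 1) 1 1"
      proof (intro conjI allI impI; (elim conjE)?)
        fix n f df xs x0 and P :: "'xi measure" and g :: "vec \<Rightarrow> 'xi \<Rightarrow> vec"
        assume *: "is_minimizer n f xs" "x0 \<in> Rn n" "dist_Rn n x0 xs \<le> R0"
          "gradient_field n \<nu> f xs (cball_Rn n xs (3 * R0)) df"
          "smoothness_cond n \<nu> M f xs (cball_Rn n xs (3 * R0)) df"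
          "oracle_cond n \<sigma> (cball_Rn n xs (3 * R0)) df P g"
        let ?S = "sample_space 0 (\<lambda>_. 1) P"
        interpret holder_problem n \<nu> M R0 f df xs
          by unfold_locales (use assms pos * in auto)
        interpret S: prob_space ?S
          unfolding sample_space_def
          by (intro prob_space_PiM) (use *(6) in \<open>simp add: oracle_cond_def\<close>)
        have "f x0 - f xs \<le> \<epsilon>"
          using initial_point_accurate * X pos by (simp add: X_def)
        then have "{\<omega> \<in> space ?S. f (sstm_output n \<nu> 0 (\<lambda>_. 1) 1 1 g x0 \<omega>) - f xs \<le> \<epsilon>} = space ?S"
          by (simp add: sstm_output_def)
        then show "1 - \<beta> \<le> \<P>(\<omega> in ?S. f (sstm_output n \<nu> 0 (\<lambda>_. 1) 1 1 g x0 \<omega>) - f xs \<le> \<epsilon>)"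
          using pos S.prob_space by simp
      qed (use I0 in \<open>auto simp: oracle_calls_def\<close>)
      then show ?thesis by blast
    next
      case False
      then have D1: "1 < D" by simp
      define L where "L = log_factor D \<beta>"
      obtain N \<alpha> B where sched: "sstm_schedule \<nu> M R0 \<epsilon> L N \<alpha> B"
        and N_le: "real N \<le> 1537 * iteration_bound \<nu> D \<beta>"
        using schedule_exists[OF assms pos(1,2,4,5,6)] D1 unfolding D_def L_def by blast
      interpret sstm_schedule \<nu> M R0 \<epsilon> L N \<alpha> B by (rule sched)
      have "?works N (batch_size \<sigma>) \<alpha> B"
      proof (intro conjI allI impI; (elim conjE)?)
        show "real N \<le> 4000 * iteration_bound \<nu> D \<beta>" using N_le I0 by linarith
        \<comment> \<open>the maximum is at least each of its entries, and \<open>1537 + 2304 \<le> 4000\<close>\<close>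
        show "real (oracle_calls N (batch_size \<sigma>))
         \<le> 4000 * max (iteration_bound \<nu> D \<beta>) (\<sigma>\<^sup>2 * R0\<^sup>2 / \<epsilon>\<^sup>2 * log_factor D \<beta>)"
          using total_batch_size[of \<sigma>] N_le unfolding L_def by linarith
        fix n f df xs x0 and P :: "'xi measure" and g :: "vec \<Rightarrow> 'xi \<Rightarrow> vec"
        assume *: "is_minimizer n f xs" "x0 \<in> Rn n" "dist_Rn n x0 xs \<le> R0"
          "gradient_field n \<nu> f xs (cball_Rn n xs (3 * R0)) df"
          "smoothness_cond n \<nu> M f xs (cball_Rn n xs (3 * R0)) df"
          "oracle_cond n \<sigma> (cball_Rn n xs (3 * R0)) df P g"
        interpret run: clipped_sstm n \<nu> M R0 f df xs \<epsilon> L N \<alpha> B \<sigma> "batch_size \<sigma>" P g x0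
          by unfold_locales (use assms pos * batch_size_ge in auto)
        have "1 - \<beta> \<le> 1 - exp (- L)"
          using exp_minus_log_factor_le[of D \<beta>] D1 pos by (simp add: L_def)
        also have "\<dots> \<le> \<P>(\<omega> in sample_space N (batch_size \<sigma>) P.
            f (sstm_output n \<nu> N (batch_size \<sigma>) \<alpha> B g x0 \<omega>) - f xs \<le> \<epsilon>)"
          by (rule run.high_probability_accuracy)
        finally show "1 - \<beta> \<le> \<P>(\<omega> in sample_space N (batch_size \<sigma>) P.
            f (sstm_output n \<nu> N (batch_size \<sigma>) \<alpha> B g x0 \<omega>) - f xs \<le> \<epsilon>)" .
      qed (use \<alpha>_pos B_pos batch_size_ge in auto)
      then show ?thesis by blast
    qed
  qed
  then show ?thesis
    unfolding Let_def by (intro exI[of _ "4000 :: real"]) simp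
qed

end
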